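(* Assume that $(H_1)$, $(H_1^{\mathcal A})$, $(H_2^{\mathcal A})$ and $(H_4^{\mathcal A})$ (as stated in the context) hold, with activation functions $g_i$ of class $\mathcal A$. Then for each $\Sigma\in\{1,2\}^N$ there exists a unique almost periodic solution of (GNN) which is exponentially stable in $\mathcal K^\Sigma$.
   Context: **System.** Let $N,M\ge1$ be integers; indices satisfy $i,j\in\{1,\dots,N\}$, $l\in\{1,\dots,M\}$. The general neural network (GNN) is $$\frac{du^i(t)}{dt}=-c_i(t)u^i(t)+\sum_{l=1}^M\sum_{j=1}^N a_{ijl}(t)\,g_j\big(\sigma_j u^j(t-\kappa_{ijl}(t))\big)+J_i(t),\qquad i=1,\dots,N. \tag{GNN}$$ The delays satisfy $0<\kappa_{ijl}(t)\le\kappa_{ijl}$ with constants $\kappa_{ijl}$, and $\kappa:=\max_{i,j,l}\kappa_{ijl}$. For $\phi\in C([-\kappa,0],\mathbb R^N)$, $u(t;\phi)$ denotes the solution of (GNN) for $t\ge0$ with $u(s;\phi)=\phi(s)$ on $[-\kappa,0]$; for a function $u$ write $u_t(s)=u(t+s)$, $s\in[-\kappa,0]$. The norm is $\|\phi\|_\kappa=\max_i\sup_{s\in[-\kappa,0]}|\phi^i(s)|$. **Almost periodic** is in the sense of Bohr: a continuous $f:\mathbb R\to\mathbb R$ such that for each $\epsilon>0$ the set $\{T:|f(t+T)-f(t)|<\epsilon\ \forall t\in\mathbb R\}$ is relatively dense. A vector function is almost periodic if each component is. **$(H_1)$**: $c_i(t)>0$, $a_{ijl}(t)$, $\kappa_{ijl}(t)>0$,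 $J_i(t)$ are almost periodic functions on $\mathbb R$; $\sigma_j>0$ are constants; $a_{iil}(t)>0$. **Class $\mathcal A$**: $g_i\in C^2(\mathbb R)$, $|g_i(x)|\le B_i$ for a constant $B_i$, $g_i(0)=0$, $\dot g_i(x)>0$ for all $x\in\mathbb R$, and $x\ddot g_i(x)<0$ for all $x\ne0$. **Auxiliary functions**: $F_i(z)=-\big(\sup_{t}c_i(t)\big)z+\big(\inf_{t}\sum_{l=1}^M a_{iil}(t)\big)g_i(\sigma_i z)$. All $\sup$ and $\inf$ over $t$ are over $t\in\mathbb R$. **$(H_1^{\mathcal A})$**: for every $i$, $$\inf_{\zeta\in\mathbb R}\dot g_i(\zeta)<\frac{\sup_t c_i(t)}{\sigma_i\inf_t\sum_{l=1}^M a_{iil}(t)}<\sup_{\zeta\in\mathbb R}\dot g_i(\zeta)$$ (in particular $\inf_t\sum_l a_{iil}(t)>0$). Under this condition $\dot F_i$ has exactly two zeros $z_{i1}<0<z_{i2}$. **$(H_2^{\mathcal A})$**: for every $i$, $k=1,2$ and all $t\in\mathbb R$, $$(-1)^k\{F_i(z_{ik})+J_i(t)\}>\sum_{l=1}^M\sum_{j\ne i}\sup_{t}|a_{ijl}(t)|B_j .$$ **Basins**: $\beta_{i1}:=\hat z_{i1}$ is the point $\hat z_{i1}<z_{i1}$ with $F_i(\hat z_{i1})+\sum_{l}\sum_{j\ne i}\sup_t|a_{ijl}(t)|B_j+\sup_tJ_i(t)=0$; $\alpha_{i2}:=\tilde z_{i2}$ is the point $\tilde z_{i2}>z_{i2}$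 with $F_i(\tilde z_{i2})-\sum_{l}\sum_{j\ne i}\sup_t|a_{ijl}(t)|B_j+\inf_tJ_i(t)=0$. Set $$\mathcal K_{i1}=\{\psi\in C([-\kappa,0],\mathbb R):\psi(s)\le\beta_{i1}\ \forall s\},\qquad \mathcal K_{i2}=\{\psi\in C([-\kappa,0],\mathbb R):\psi(s)\ge\alpha_{i2}\ \forall s\},$$ and $\mathcal K^\Sigma=\mathcal K_{1\varsigma_1}\times\cdots\times\mathcal K_{N\varsigma_N}$ for $\Sigma=(\varsigma_1,\dots,\varsigma_N)\in\{1,2\}^N$. **$(H_4^{\mathcal A})$**: let $\gamma_i=\max\{\dot g_i(\sigma_i\beta_{i1}),\dot g_i(\sigma_i\alpha_{i2})\}$. There exist a positive integer $m$ and positive constants $p>1$, $d_i$ ($1\le i\le N$), $o_k$ ($1\le k\le m$), $q_{jlk}$, $p_{jlk}$ ($1\le j\le N$, $1\le l\le M$, $1\le k\le m+1$) with $\sum_{k=1}^m o_k=p-1$ and $\sum_{k=1}^{m+1}q_{jlk}=\sum_{k=1}^{m+1}p_{jlk}=1$ for each $j,l$, such that for every $i$ $$p\,d_i\inf_tc_i(t)>\sum_{l=1}^M\sum_{j=1}^N\Big[d_j\big(\sup_t|a_{jil}(t)|\big)^{p\,p_{il,m+1}}(\sigma_i\gamma_i)^{p\,q_{il,m+1}}+\sum_{k=1}^m d_i\,o_k\big(\sup_t|a_{ijl}(t)|\big)^{p\,p_{jlk}/o_k}(\sigma_j\gamma_j)^{p\,q_{jlk}/o_k}\Big].$$ **Exponential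 stability**: an almost periodic solution $\hat u:\mathbb R\to\mathbb R^N$ of (GNN) is exponentially stable in $\mathcal K^\Sigma$ if $\hat u_t\in\mathcal K^\Sigma$ for all $t\in\mathbb R$ and there are constants $\rho\ge1$, $\mu>0$ such that $\max_i|\hat u^i(t)-u^i(t;\phi)|\le\rho e^{-\mu t}\|\hat u_0-\phi\|_\kappa$ for all $t\ge0$ and all $\phi\in\mathcal K^\Sigma$. *)

theory Defs
  imports "HOL-Analysis.Analysis"
begin

text \<open>
  Neurons are indexed by a finite type \<open>'n\<close> and delay channels by a finite type \<open>'m\<close>, so
  \<open>N = CARD('n)\<close>, \<open>M = CARD('m)\<close>. The data of the network are
  \<open>c i t\<close>, \<open>a i j l t\<close>, \<open>g j\<close>, \<open>\<sigma> j\<close>, the delays \<open>\<tau> i j l t\<close> with constant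
  bounds \<open>\<kappa> i j l\<close>, and the inputs \<open>J i t\<close>. Histories are functions of type
  \<open>real \<Rightarrow> real ^ 'n\<close> of which only the values on \<open>{-max_delay \<kappa>..0}\<close> are used.
\<close>

definition relatively_dense :: "real set \<Rightarrow> bool" where
  "relatively_dense S \<longleftrightarrow> (\<exists>L>0. \<forall>x. \<exists>T\<in>S. x \<le> T \<and> T \<le> x + L)"

definition almost_periodic :: "(real \<Rightarrow> real) \<Rightarrow> bool" where
  "almost_periodic f \<longleftrightarrow> continuous_on UNIV f \<and>
     (\<forall>\<epsilon>>0. relatively_dense {T. \<forall>t. \<bar>f (t + T) - f t\<bar> < \<epsilon>})"

definition almost_periodic_vec :: "(real \<Rightarrow> real ^ 'n) \<Rightarrow> bool" where
  "almost_periodic_vec u \<longleftrightarrow> (\<forall>i. almost_periodic (\<lambda>t. u t $ i))"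

definition max_delay :: "('n::finite \<Rightarrow> 'n \<Rightarrow> 'm::finite \<Rightarrow> real) \<Rightarrow> real" where
  "max_delay \<kappa> = Max {\<kappa> i j l | i j l. True}"

definition gnn_rhs ::
  "('n::finite \<Rightarrow> real \<Rightarrow> real) \<Rightarrow> ('n \<Rightarrow> 'n \<Rightarrow> 'm::finite \<Rightarrow> real \<Rightarrow> real) \<Rightarrow>
   ('n \<Rightarrow> real \<Rightarrow> real) \<Rightarrow> ('n \<Rightarrow> real) \<Rightarrow> ('n \<Rightarrow> 'n \<Rightarrow> 'm \<Rightarrow> real \<Rightarrow> real) \<Rightarrow>
   ('n \<Rightarrow> real \<Rightarrow> real) \<Rightarrow> (real \<Rightarrow> real ^ 'n) \<Rightarrow> real \<Rightarrow> 'n \<Rightarrow> real" where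
  "gnn_rhs c a g \<sigma> \<tau> J u t i =
     - c i t * u t $ i
     + (\<Sum>l\<in>UNIV. \<Sum>j\<in>UNIV. a i j l t * g j (\<sigma> j * u (t - \<tau> i j l t) $ j))
     + J i t"

text \<open>Solutions on the whole real line.\<close>

definition gnn_solution ::
  "('n::finite \<Rightarrow> real \<Rightarrow> real) \<Rightarrow> ('n \<Rightarrow> 'n \<Rightarrow> 'm::finite \<Rightarrow> real \<Rightarrow> real) \<Rightarrow>
   ('n \<Rightarrow> real \<Rightarrow> real) \<Rightarrow> ('n \<Rightarrow> real) \<Rightarrow> ('n \<Rightarrow> 'n \<Rightarrow> 'm \<Rightarrow> real \<Rightarrow> real) \<Rightarrow>
   ('n \<Rightarrow> real \<Rightarrow> real) \<Rightarrow> (real \<Rightarrow> real ^ 'n) \<Rightarrow> bool" where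
  "gnn_solution c a g \<sigma> \<tau> J u \<longleftrightarrow>
     (\<forall>t i. ((\<lambda>s. u s $ i) has_real_derivative gnn_rhs c a g \<sigma> \<tau> J u t i) (at t))"

text \<open>
  Solutions of the initial value problem; the derivative at \<open>0\<close> is one-sided, and the values of
  \<open>u\<close> before \<open>-max_delay \<kappa>\<close> are irrelevant.
\<close>

definition gnn_ivp_solution ::
  "('n::finite \<Rightarrow> real \<Rightarrow> real) \<Rightarrow> ('n \<Rightarrow> 'n \<Rightarrow> 'm::finite \<Rightarrow> real \<Rightarrow> real) \<Rightarrow>
   ('n \<Rightarrow> real \<Rightarrow> real) \<Rightarrow> ('n \<Rightarrow> real) \<Rightarrow> ('n \<Rightarrow> 'n \<Rightarrow> 'm \<Rightarrow> real \<Rightarrow> real) \<Rightarrow>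
   ('n \<Rightarrow> 'n \<Rightarrow> 'm \<Rightarrow> real) \<Rightarrow> ('n \<Rightarrow> real \<Rightarrow> real) \<Rightarrow>
   (real \<Rightarrow> real ^ 'n) \<Rightarrow> (real \<Rightarrow> real ^ 'n) \<Rightarrow> bool" where
  "gnn_ivp_solution c a g \<sigma> \<tau> \<kappa> J \<phi> u \<longleftrightarrow>
     continuous_on {-max_delay \<kappa>..} u \<and>
     (\<forall>s\<in>{-max_delay \<kappa>..0}. u s = \<phi> s) \<and>
     (\<forall>t\<ge>0. \<forall>i. ((\<lambda>s. u s $ i) has_real_derivative gnn_rhs c a g \<sigma> \<tau> J u t i)
        (at t within {0..}))"

definition history_norm :: "real \<Rightarrow> (real \<Rightarrow> real ^ 'n::finite) \<Rightarrow> real" where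
  "history_norm k \<phi> = (MAX i. SUP s\<in>{-k..0}. \<bar>\<phi> s $ i\<bar>)"

definition segment :: "(real \<Rightarrow> real ^ 'n) \<Rightarrow> real \<Rightarrow> real \<Rightarrow> real ^ 'n" where
  "segment u t = (\<lambda>s. u (t + s))"

definition H1 ::
  "('n::finite \<Rightarrow> real \<Rightarrow> real) \<Rightarrow> ('n \<Rightarrow> 'n \<Rightarrow> 'm::finite \<Rightarrow> real \<Rightarrow> real) \<Rightarrow>
   ('n \<Rightarrow> real) \<Rightarrow> ('n \<Rightarrow> 'n \<Rightarrow> 'm \<Rightarrow> real \<Rightarrow> real) \<Rightarrow> ('n \<Rightarrow> real \<Rightarrow> real) \<Rightarrow> bool" where
  "H1 c a \<sigma> \<tau> J \<longleftrightarrow>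
     (\<forall>i. almost_periodic (c i) \<and> (\<forall>t. c i t > 0)) \<and>
     (\<forall>i j l. almost_periodic (a i j l)) \<and>
     (\<forall>i j l. almost_periodic (\<tau> i j l) \<and> (\<forall>t. \<tau> i j l t > 0)) \<and>
     (\<forall>i. almost_periodic (J i)) \<and>
     (\<forall>j. \<sigma> j > 0) \<and>
     (\<forall>i l t. a i i l t > 0)"

definition class_A :: "(real \<Rightarrow> real) \<Rightarrow> real \<Rightarrow> bool" where
  "class_A f b \<longleftrightarrow>
     (\<forall>x. f differentiable (at x)) \<and>
     (\<forall>x. deriv f differentiable (at x)) \<and>
     continuous_on UNIV (deriv (deriv f)) \<and>
     (\<forall>x. \<bar>f x\<bar> \<le> b) \<and>
     f 0 = 0 \<and>
     (\<forall>x. deriv f x > 0) \<and>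
     (\<forall>x. x \<noteq> 0 \<longrightarrow> x * deriv (deriv f) x < 0)"

definition aux_F ::
  "('n::finite \<Rightarrow> real \<Rightarrow> real) \<Rightarrow> ('n \<Rightarrow> 'n \<Rightarrow> 'm::finite \<Rightarrow> real \<Rightarrow> real) \<Rightarrow>
   ('n \<Rightarrow> real \<Rightarrow> real) \<Rightarrow> ('n \<Rightarrow> real) \<Rightarrow> 'n \<Rightarrow> real \<Rightarrow> real" where
  "aux_F c a g \<sigma> i z =
     - (SUP t. c i t) * z + (INF t. \<Sum>l\<in>UNIV. a i i l t) * g i (\<sigma> i * z)"

definition H1_A ::
  "('n::finite \<Rightarrow> real \<Rightarrow> real) \<Rightarrow> ('n \<Rightarrow> 'n \<Rightarrow> 'm::finite \<Rightarrow> real \<Rightarrow> real) \<Rightarrow>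
   ('n \<Rightarrow> real \<Rightarrow> real) \<Rightarrow> ('n \<Rightarrow> real) \<Rightarrow> bool" where
  "H1_A c a g \<sigma> \<longleftrightarrow>
     (\<forall>i. (INF x. deriv (g i) x) < (SUP t. c i t) / (\<sigma> i * (INF t. \<Sum>l\<in>UNIV. a i i l t)) \<and>
          (SUP t. c i t) / (\<sigma> i * (INF t. \<Sum>l\<in>UNIV. a i i l t)) < (SUP x. deriv (g i) x))"

text \<open>
  \<open>crit_pt c a g \<sigma> i 1\<close> and \<open>crit_pt c a g \<sigma> i 2\<close> are the negative and the positive zero of
  the derivative of \<open>aux_F c a g \<sigma> i\<close>. Both exist and are unique under \<open>H1\<close>, \<open>class_A\<close> and \<open>H1_A\<close>:
  boundedness of \<open>g i\<close> makes the infimum in \<open>H1_A\<close> equal to \<open>0\<close>, the limit of the derivative of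
  \<open>g i\<close> at both infinities.
\<close>

definition crit_pt ::
  "('n::finite \<Rightarrow> real \<Rightarrow> real) \<Rightarrow> ('n \<Rightarrow> 'n \<Rightarrow> 'm::finite \<Rightarrow> real \<Rightarrow> real) \<Rightarrow>
   ('n \<Rightarrow> real \<Rightarrow> real) \<Rightarrow> ('n \<Rightarrow> real) \<Rightarrow> 'n \<Rightarrow> nat \<Rightarrow> real" where
  "crit_pt c a g \<sigma> i k =
     (THE z. deriv (aux_F c a g \<sigma> i) z = 0 \<and> (if k = 1 then z < 0 else z > 0))"

definition cross_bound ::
  "('n::finite \<Rightarrow> 'n \<Rightarrow> 'm::finite \<Rightarrow> real \<Rightarrow> real) \<Rightarrow> ('n \<Rightarrow> real) \<Rightarrow> 'n \<Rightarrow> real" where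
  "cross_bound a B i = (\<Sum>l\<in>UNIV. \<Sum>j\<in>UNIV - {i}. (SUP t. \<bar>a i j l t\<bar>) * B j)"

definition H2_A ::
  "('n::finite \<Rightarrow> real \<Rightarrow> real) \<Rightarrow> ('n \<Rightarrow> 'n \<Rightarrow> 'm::finite \<Rightarrow> real \<Rightarrow> real) \<Rightarrow>
   ('n \<Rightarrow> real \<Rightarrow> real) \<Rightarrow> ('n \<Rightarrow> real) \<Rightarrow> ('n \<Rightarrow> real \<Rightarrow> real) \<Rightarrow> ('n \<Rightarrow> real) \<Rightarrow> bool" where
  "H2_A c a g \<sigma> J B \<longleftrightarrow>
     (\<forall>i. \<forall>k\<in>{1, 2}. \<forall>t.
        (-1) ^ k * (aux_F c a g \<sigma> i (crit_pt c a g \<sigma> i k) + J i t) > cross_bound a B i)"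

text \<open>
  \<open>aux_F c a g \<sigma> i\<close> is strictly decreasing to the left of \<open>crit_pt c a g \<sigma> i 1\<close> and to the right of
  \<open>crit_pt c a g \<sigma> i 2\<close>, so the following two predicates determine \<open>x\<close> uniquely.
\<close>

definition is_beta ::
  "('n::finite \<Rightarrow> real \<Rightarrow> real) \<Rightarrow> ('n \<Rightarrow> 'n \<Rightarrow> 'm::finite \<Rightarrow> real \<Rightarrow> real) \<Rightarrow>
   ('n \<Rightarrow> real \<Rightarrow> real) \<Rightarrow> ('n \<Rightarrow> real) \<Rightarrow> ('n \<Rightarrow> real \<Rightarrow> real) \<Rightarrow> ('n \<Rightarrow> real) \<Rightarrow>
   'n \<Rightarrow> real \<Rightarrow> bool" where
  "is_beta c a g \<sigma> J B i x \<longleftrightarrow>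
     x < crit_pt c a g \<sigma> i 1 \<and>
     aux_F c a g \<sigma> i x + cross_bound a B i + (SUP t. J i t) = 0"

definition is_alpha ::
  "('n::finite \<Rightarrow> real \<Rightarrow> real) \<Rightarrow> ('n \<Rightarrow> 'n \<Rightarrow> 'm::finite \<Rightarrow> real \<Rightarrow> real) \<Rightarrow>
   ('n \<Rightarrow> real \<Rightarrow> real) \<Rightarrow> ('n \<Rightarrow> real) \<Rightarrow> ('n \<Rightarrow> real \<Rightarrow> real) \<Rightarrow> ('n \<Rightarrow> real) \<Rightarrow>
   'n \<Rightarrow> real \<Rightarrow> bool" where
  "is_alpha c a g \<sigma> J B i x \<longleftrightarrow>
     x > crit_pt c a g \<sigma> i 2 \<and>
     aux_F c a g \<sigma> i x - cross_bound a B i + (INF t. J i t) = 0"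

definition basin_comp :: "real \<Rightarrow> real \<Rightarrow> real \<Rightarrow> nat \<Rightarrow> (real \<Rightarrow> real) set" where
  "basin_comp k b e k' =
     {\<psi>. continuous_on {-k..0} \<psi> \<and>
          (\<forall>s\<in>{-k..0}. if k' = 1 then \<psi> s \<le> b else \<psi> s \<ge> e)}"

definition basin ::
  "real \<Rightarrow> ('n::finite \<Rightarrow> real) \<Rightarrow> ('n \<Rightarrow> real) \<Rightarrow> ('n \<Rightarrow> nat) \<Rightarrow> (real \<Rightarrow> real ^ 'n) set" where
  "basin k \<beta> \<alpha> \<Sigma> = {\<phi>. \<forall>i. (\<lambda>s. \<phi> s $ i) \<in> basin_comp k (\<beta> i) (\<alpha> i) (\<Sigma> i)}"

definition H4_A ::
  "('n::finite \<Rightarrow> real \<Rightarrow> real) \<Rightarrow> ('n \<Rightarrow> 'n \<Rightarrow> 'm::finite \<Rightarrow> real \<Rightarrow> real) \<Rightarrow>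
   ('n \<Rightarrow> real \<Rightarrow> real) \<Rightarrow> ('n \<Rightarrow> real) \<Rightarrow> ('n \<Rightarrow> real) \<Rightarrow> ('n \<Rightarrow> real) \<Rightarrow> bool" where
  "H4_A c a g \<sigma> \<beta> \<alpha> \<longleftrightarrow>
     (let \<gamma> = (\<lambda>i. max (deriv (g i) (\<sigma> i * \<beta> i)) (deriv (g i) (\<sigma> i * \<alpha> i)));
          A = (\<lambda>i j l. SUP t. \<bar>a i j l t\<bar>)
      in \<exists>(m::nat) (p::real) (d :: 'n \<Rightarrow> real) (h :: nat \<Rightarrow> real)
           (q :: 'n \<Rightarrow> 'm \<Rightarrow> nat \<Rightarrow> real) (r :: 'n \<Rightarrow> 'm \<Rightarrow> nat \<Rightarrow> real).
         m \<ge> 1 \<and> p > 1 \<and> (\<forall>i. d i > 0) \<and> (\<forall>k\<in>{1..m}. h k > 0) \<and>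
         (\<forall>j l. \<forall>k\<in>{1..m+1}. q j l k > 0 \<and> r j l k > 0) \<and>
         (\<Sum>k=1..m. h k) = p - 1 \<and>
         (\<forall>j l. (\<Sum>k=1..m+1. q j l k) = 1 \<and> (\<Sum>k=1..m+1. r j l k) = 1) \<and>
         (\<forall>i. p * d i * (INF t. c i t) >
            (\<Sum>l\<in>UNIV. \<Sum>j\<in>UNIV.
               d j * A j i l powr (p * r i l (m+1)) * (\<sigma> i * \<gamma> i) powr (p * q i l (m+1)) +
               (\<Sum>k=1..m. d i * h k * A i j l powr (p * r j l k / h k)
                            * (\<sigma> j * \<gamma> j) powr (p * q j l k / h k)))))"

text \<open>
  Stability asks for the existence of a solution from each initial function in the basin, so that
  the estimate, imposed on every such solution, is never vacuous.
\<close>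

definition exp_stable_in ::
  "('n::finite \<Rightarrow> real \<Rightarrow> real) \<Rightarrow> ('n \<Rightarrow> 'n \<Rightarrow> 'm::finite \<Rightarrow> real \<Rightarrow> real) \<Rightarrow>
   ('n \<Rightarrow> real \<Rightarrow> real) \<Rightarrow> ('n \<Rightarrow> real) \<Rightarrow> ('n \<Rightarrow> 'n \<Rightarrow> 'm \<Rightarrow> real \<Rightarrow> real) \<Rightarrow>
   ('n \<Rightarrow> 'n \<Rightarrow> 'm \<Rightarrow> real) \<Rightarrow> ('n \<Rightarrow> real \<Rightarrow> real) \<Rightarrow>
   (real \<Rightarrow> real ^ 'n) set \<Rightarrow> (real \<Rightarrow> real ^ 'n) \<Rightarrow> bool" where
  "exp_stable_in c a g \<sigma> \<tau> \<kappa> J K uh \<longleftrightarrow>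
     (\<forall>t. segment uh t \<in> K) \<and>
     (\<exists>\<rho>\<ge>1. \<exists>\<mu>>0. \<forall>\<phi>\<in>K.
        (\<exists>u. gnn_ivp_solution c a g \<sigma> \<tau> \<kappa> J \<phi> u) \<and>
        (\<forall>u. gnn_ivp_solution c a g \<sigma> \<tau> \<kappa> J \<phi> u \<longrightarrow>
           (\<forall>t\<ge>0. (MAX i. \<bar>uh t $ i - u t $ i\<bar>)
              \<le> \<rho> * exp (- \<mu> * t) * history_norm (max_delay \<kappa>) (\<lambda>s. segment uh 0 s - \<phi> s))))"

end

theory Submission
  imports Defs
begin

text \<open>
  Young's inequality turns \<open>H4_A\<close> into a statement without exponents: with
  \<open>K i j = \<Sum> l. sup \<bar>a i j l\<bar> * \<sigma> j * \<gamma> j\<close>, no nonnegative \<open>w \<noteq> 0\<close> satisfies \<open>inf c * w \<le> K w\<close>.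
  Hence \<open>inf c - K\<close> is a nonsingular M-matrix and some \<open>\<xi> > 0\<close> satisfies \<open>K \<xi> < inf c * \<xi>\<close>.
  Since \<open>\<sigma> j * \<gamma> j\<close> is a Lipschitz constant of \<open>g j (\<sigma> j \<cdot>)\<close> beyond \<open>\<beta> j\<close> and \<open>\<alpha> j\<close>, solving the
  linear equations \<open>v' = - c v + forcing u\<close> is a contraction \<open>u \<mapsto> v\<close> in the supremum norm weighted by
  \<open>\<xi>\<close>. This norm, unlike a Lyapunov functional, tolerates delays that vary arbitrarily.

  The contraction preserves the basin, because the forcing there never exceeds \<open>c i * \<beta> i\<close>, or never
  falls below \<open>c i * \<alpha> i\<close>. It yields a unique bounded entire solution in the basin and solutions of
  all initial value problems. The entire solution is almost periodic: translation by a common almost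
  period of the coefficients perturbs the fixed point equation only slightly. The exponential estimate
  is the same contraction argument for \<open>exp (\<mu> t)\<close> times a difference, with small \<open>\<mu>\<close>.
\<close>

section \<open>Almost periodic functions\<close>

text \<open>\<open>H4_A\<close> controls weighted sums of \<open>w i powr p\<close> and does not
  display weights for a supremum norm. The detour is linear algebra: once nonzero nonnegative
  \<open>w\<close> with \<open>c0 i * w $ i \<le> (K *v w) $ i\<close> are excluded, the matrix with
  diagonal \<open>c0\<close> minus \<open>K\<close> is invertible, and \<open>\<xi>\<close> is the
  preimage of the vector of ones. The Lipschitz constants \<open>s j\<close> hold only inside the
  sector. Picard iterates stay there by construction, but an arbitrary solution of an initial value
  problem has to be shown to remain there before any contraction estimate applies. That is an
  induction along delayed times, while existence is a single fixed point on the whole half line. On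
  the full line there is no initial value. Boundedness takes its place in every comparison, because
  the influence of the value at time \<open>t - s\<close> decays at least like
  \<open>exp (- c0 * s)\<close>. Uniqueness rests on this as well: an almost periodic solution is
  bounded, stability places it in the sector, and two bounded entire solutions there
  coincide.\<close>

lemma almost_periodic_continuous: "almost_periodic f \<Longrightarrow> continuous_on S f"
  unfolding almost_periodic_def by (meson continuous_on_subset subset_UNIV)

lemma almost_periodic_translate:
  assumes "almost_periodic f" "\<epsilon> > 0"
  obtains L where "L > 0" "\<And>x. \<exists>T. x \<le> T \<and> T \<le> x + L \<and> (\<forall>t. \<bar>f (t + T) - f t\<bar> < \<epsilon>)"
proof -
  have "relatively_dense {T. \<forall>t. \<bar>f (t + T) - f t\<bar> < \<epsilon>}"
    using assms unfolding almost_periodic_def by simp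
  then obtain L where L: "L > 0" "\<And>x. \<exists>T\<in>{T. \<forall>t. \<bar>f (t + T) - f t\<bar> < \<epsilon>}. x \<le> T \<and> T \<le> x + L"
    unfolding relatively_dense_def by blast
  show ?thesis
    by (rule that[OF L(1)]) (use L(2) in blast)
qed

text \<open>Every \<open>t\<close> is moved into the compact window \<open>{0..L}\<close> by an
  almost period for tolerance 1, which changes \<open>f\<close> by less than 1.\<close>

lemma almost_periodic_bounded:
  assumes "almost_periodic f"
  obtains K where "\<And>t. \<bar>f t\<bar> \<le> K"
proof -
  obtain L where L: "L > 0" "\<And>x. \<exists>T. x \<le> T \<and> T \<le> x + L \<and> (\<forall>t. \<bar>f (t + T) - f t\<bar> < 1)"
    by (rule almost_periodic_translate[OF assms, of 1]) auto
  have "bounded (f ` {0..L})"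
    using compact_continuous_image[OF almost_periodic_continuous[OF assms] compact_Icc]
    by (rule compact_imp_bounded)
  then obtain K where K: "\<And>t. t \<in> {0..L} \<Longrightarrow> \<bar>f t\<bar> \<le> K"
    unfolding bounded_iff real_norm_def by blast
  have "\<bar>f t\<bar> \<le> K + 1" for t
  proof -
    obtain T where T: "- t \<le> T" "T \<le> - t + L" "\<bar>f (t + T) - f t\<bar> < 1" using L(2)[of "- t"] by blast
    then have "\<bar>f (t + T)\<bar> \<le> K" by (intro K) simp
    then show ?thesis using T(3) by linarith
  qed
  then show ?thesis by (rule that)
qed

lemma almost_periodic_bdd:
  assumes "almost_periodic f"
  shows "bdd_above (range f)" "bdd_below (range f)" "bdd_above (range (\<lambda>t. \<bar>f t\<bar>))"
proof -
  obtain K where K: "\<And>t. \<bar>f t\<bar> \<le> K" using almost_periodic_bounded[OF assms] by blast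
  have "- K \<le> f t" "f t \<le> K" for t using K[of t] by auto
  then show "bdd_below (range f)" by (intro bdd_belowI2)
  show "bdd_above (range f)" using \<open>\<And>t. f t \<le> K\<close> by (rule bdd_aboveI2)
  show "bdd_above (range (\<lambda>t. \<bar>f t\<bar>))" using K by (rule bdd_aboveI2)
qed

lemma almost_periodic_uniformly_continuous:
  assumes "almost_periodic f" "\<epsilon> > 0"
  obtains \<eta> where "\<eta> > 0" "\<And>s t. \<bar>s - t\<bar> < \<eta> \<Longrightarrow> \<bar>f s - f t\<bar> < \<epsilon>"
proof -
  obtain L where L: "L > 0" "\<And>x. \<exists>T. x \<le> T \<and> T \<le> x + L \<and> (\<forall>t. \<bar>f (t + T) - f t\<bar> < \<epsilon> / 3)"
    by (rule almost_periodic_translate[OF assms(1), of "\<epsilon> / 3"]) (use assms(2) in auto)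
  \<comment> \<open>The shift puts \<open>t\<close> into \<open>{1..L + 1}\<close>; the extra unit
    on each side keeps a neighbour \<open>s\<close> with \<open>\<bar>s - t\<bar> < 1\<close> in the
    window.\<close>
  have "uniformly_continuous_on {0..L + 2} f"
    by (rule compact_uniformly_continuous[OF almost_periodic_continuous[OF assms(1)] compact_Icc])
  then obtain \<eta> where \<eta>: "\<eta> > 0"
    "\<And>s t. s \<in> {0..L + 2} \<Longrightarrow> t \<in> {0..L + 2} \<Longrightarrow> \<bar>s - t\<bar> < \<eta> \<Longrightarrow> \<bar>f s - f t\<bar> < \<epsilon> / 3"
    using assms(2) unfolding uniformly_continuous_on_def dist_real_def
    by (elim allE[of _ "\<epsilon> / 3"]) auto
  have "\<bar>f s - f t\<bar> < \<epsilon>" if "\<bar>s - t\<bar> < min \<eta> 1" for s t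
  proof -
    obtain T where T: "- t + 1 \<le> T" "T \<le> - t + 1 + L" "\<And>t. \<bar>f (t + T) - f t\<bar> < \<epsilon> / 3"
      using L(2)[of "- t + 1"] by blast
    have "\<bar>f (s + T) - f (t + T)\<bar> < \<epsilon> / 3"
      by (rule \<eta>(2)) (use T that in auto)
    then show ?thesis using T(3)[of s] T(3)[of t] by linarith
  qed
  then show ?thesis by (intro that[of "min \<eta> 1"]) (use \<eta>(1) in simp_all)
qed

text \<open>Half of Bochner's criterion: the translates of \<open>f\<close> are totally bounded in
  the supremum norm. Subtracting an almost period brings \<open>h\<close> into
  \<open>{0..L}\<close>, and rounding down to a grid of mesh \<open>\<eta>\<close> leaves finitely
  many representatives \<open>r h\<close>.\<close>

lemma almost_periodic_translates_totally_bounded: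
  assumes "almost_periodic f" "\<epsilon> > 0"
  obtains r :: "real \<Rightarrow> real"
  where "finite (range r)" "\<And>h t. \<bar>f (t + h) - f (t + r h)\<bar> < \<epsilon>"
proof -
  obtain L where L: "L > 0" "\<And>x. \<exists>T. x \<le> T \<and> T \<le> x + L \<and> (\<forall>t. \<bar>f (t + T) - f t\<bar> < \<epsilon> / 2)"
    by (rule almost_periodic_translate[OF assms(1), of "\<epsilon> / 2"]) (use assms(2) in auto)
  obtain \<eta> where \<eta>: "\<eta> > 0" "\<And>s t. \<bar>s - t\<bar> < \<eta> \<Longrightarrow> \<bar>f s - f t\<bar> < \<epsilon> / 2"
    by (rule almost_periodic_uniformly_continuous[OF assms(1), of "\<epsilon> / 2"]) (use assms(2) in auto)
  have "\<exists>T. h - L \<le> T \<and> T \<le> h \<and> (\<forall>t. \<bar>f (t + T) - f t\<bar> < \<epsilon> / 2)" for h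
    using L(2)[of "h - L"] by simp
  then obtain T where T: "\<And>h. h - L \<le> T h" "\<And>h. T h \<le> h" "\<And>h t. \<bar>f (t + T h) - f t\<bar> < \<epsilon> / 2"
    by metis
  define r where "r h = \<eta> * of_int \<lfloor>(h - T h) / \<eta>\<rfloor>" for h
  have "range r \<subseteq> (\<lambda>n. \<eta> * of_int n) ` {0..\<lfloor>L / \<eta>\<rfloor>}"
  proof (rule image_subsetI)
    fix h
    have "0 \<le> (h - T h) / \<eta>" "(h - T h) / \<eta> \<le> L / \<eta>"
      using T(1,2)[of h] \<eta>(1) by (auto simp: divide_le_cancel)
    then show "r h \<in> (\<lambda>n. \<eta> * of_int n) ` {0..\<lfloor>L / \<eta>\<rfloor>}"
      unfolding r_def by (intro imageI) (auto intro: floor_mono)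
  qed
  then have "finite (range r)" by (rule finite_subset) auto
  moreover have "\<bar>f (t + h) - f (t + r h)\<bar> < \<epsilon>" for h t
  proof -
    have "\<bar>f (t + h) - f (t + (h - T h))\<bar> < \<epsilon> / 2"
      using T(3)[of "t + (h - T h)" h] by simp
    moreover have "\<bar>f (t + (h - T h)) - f (t + r h)\<bar> < \<epsilon> / 2"
    proof (rule \<eta>(2))
      have "r h \<le> h - T h" "h - T h < r h + \<eta>"
        using of_int_floor_le[of "(h - T h) / \<eta>"] floor_correct[of "(h - T h) / \<eta>"] \<eta>(1)
        unfolding r_def by (auto simp: field_simps simp del: of_int_floor_le)
      then show "\<bar>t + (h - T h) - (t + r h)\<bar> < \<eta>" by auto
    qed
    ultimately show ?thesis by linarith
  qed
  ultimately show ?thesis by (rule that)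
qed

text \<open>Relatively dense sets can have empty intersection, so the almost periods of the single
  functions cannot just be intersected. Instead, if \<open>h\<close> and \<open>h'\<close> have the
  same representatives for all \<open>f\<close>, then \<open>h - h'\<close> is a common almost
  period.\<close>

lemma common_almost_periods:
  assumes "finite \<F>" "\<And>f. f \<in> \<F> \<Longrightarrow> almost_periodic f" "\<epsilon> > 0"
  shows "relatively_dense {T. \<forall>f\<in>\<F>. \<forall>t. \<bar>f (t + T) - f t\<bar> < \<epsilon>}"
proof -
  have "\<exists>r. finite (range r) \<and> (\<forall>h t. \<bar>f (t + h) - f (t + r h)\<bar> < \<epsilon> / 2)" if "f \<in> \<F>" for f
    by (rule almost_periodic_translates_totally_bounded[OF assms(2)[OF that], of "\<epsilon> / 2"])
       (use assms(3) in auto)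
  then obtain r where r: "\<And>f. f \<in> \<F> \<Longrightarrow> finite (range (r f))"
    "\<And>f h t. f \<in> \<F> \<Longrightarrow> \<bar>f (t + h) - f (t + r f h)\<bar> < \<epsilon> / 2"
    by metis
  define q where "q h = restrict (\<lambda>f. r f h) \<F>" for h
  have "range q \<subseteq> PiE \<F> (\<lambda>f. range (r f))" unfolding q_def by auto
  then have "finite (range q)" by (rule finite_subset) (use assms(1) r(1) in \<open>auto intro!: finite_PiE\<close>)
  then have "finite (inv q ` range q)" by (rule finite_imageI)
  then have "bounded (inv q ` range q)" by (rule finite_imp_bounded)
  then obtain M where M: "M > 0" "\<And>h. \<bar>inv q (q h)\<bar> \<le> M"
    unfolding bounded_pos by auto
  have "\<exists>T\<in>{T. \<forall>f\<in>\<F>. \<forall>t. \<bar>f (t + T) - f t\<bar> < \<epsilon>}. x \<le> T \<and> T \<le> x + 2 * M" for x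
  proof (intro bexI conjI CollectI ballI allI)
    \<comment> \<open>\<open>h'\<close> is the chosen member of the class of \<open>h\<close>. All
      chosen members lie in \<open>{-M..M}\<close>, so the shift by \<open>M\<close> puts
      \<open>h - h'\<close> between \<open>x\<close> and \<open>x + 2 * M\<close>.\<close>
    define h h' where "h = x + M" and "h' = inv q (q h)"
    have "q h' = q h" unfolding h'_def by (rule f_inv_into_f) auto
    show "x \<le> h - h'" "h - h' \<le> x + 2 * M"
      using M(2)[of h] unfolding h'_def by (auto simp: h_def abs_le_iff)
    fix f t assume f: "f \<in> \<F>"
    have "r f h' = r f h" using \<open>q h' = q h\<close> f unfolding q_def by (metis restrict_apply')
    then have "\<bar>f (t - h' + h) - f (t - h' + r f h)\<bar> < \<epsilon> / 2"
      "\<bar>f t - f (t - h' + r f h)\<bar> < \<epsilon> / 2"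
      using r(2)[OF f, of "t - h'" h] r(2)[OF f, of "t - h'" h'] by auto
    then have "\<bar>f (t - h' + h) - f t\<bar> < \<epsilon>" by linarith
    then show "\<bar>f (t + (h - h')) - f t\<bar> < \<epsilon>" by (simp add: algebra_simps)
  qed
  then show ?thesis unfolding relatively_dense_def using M(1) by (intro exI[of _ "2 * M"]) auto
qed

section \<open>Scalar linear equations\<close>

lemma continuous_antiderivative:
  fixes f :: "real \<Rightarrow> real"
  assumes "continuous_on UNIV f"
  obtains F where "\<And>t. (F has_real_derivative f t) (at t)"
proof -
  have "\<exists>F. \<forall>x. - \<infinity> < ereal x \<longrightarrow> ereal x < \<infinity> \<longrightarrow> (F has_vector_derivative f x) (at x)"
    by (rule einterval_antiderivative) (use assms continuous_on_eq_continuous_at in auto)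
  then show ?thesis using that
    by (auto simp: has_real_derivative_iff_has_vector_derivative)
qed

text \<open>Integrating factor: \<open>exp (C t) * (y t - b)\<close> has derivative
  \<open>exp (C t) * (h t - c t * b)\<close>, which is never positive. Derivatives are asked for in
  the open interval only, since solutions of initial value problems have a one-sided derivative at
  0.\<close>

lemma linear_comparison_half_line:
  fixes y c h :: "real \<Rightarrow> real"
  assumes C: "\<And>t. (C has_real_derivative c t) (at t)" and "t0 \<le> t1"
    and y: "continuous_on {t0..t1} y"
    and y': "\<And>t. t0 < t \<Longrightarrow> t < t1 \<Longrightarrow> (y has_real_derivative (- c t * y t + h t)) (at t)"
    and h: "\<And>t. t0 < t \<Longrightarrow> t < t1 \<Longrightarrow> h t \<le> c t * b"
  shows "y t1 - b \<le> exp (C t0 - C t1) * (y t0 - b)"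
proof -
  let ?f = "\<lambda>t. exp (C t) * (y t - b)"
  have "?f t1 \<le> ?f t0"
  proof (rule DERIV_nonpos_imp_decreasing_open[OF \<open>t0 \<le> t1\<close>])
    fix t assume t: "t0 < t" "t < t1"
    have "(?f has_real_derivative (exp (C t) * (h t - c t * b))) (at t)"
      by (rule derivative_eq_intros C y'[OF t] refl)+ (simp add: algebra_simps)
    moreover have "exp (C t) * (h t - c t * b) \<le> 0" using h[OF t] by (simp add: mult_le_0_iff)
    ultimately show "\<exists>y. (?f has_real_derivative y) (at t) \<and> y \<le> 0" by blast
  next
    have "continuous_on {t0..t1} C" using C by (meson DERIV_isCont continuous_at_imp_continuous_on)
    then show "continuous_on {t0..t1} ?f" by (intro continuous_intros y)
  qed
  then have "exp (- C t1) * ?f t1 \<le> exp (- C t1) * ?f t0" by (intro mult_left_mono) auto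
  then have "exp (- C t1 + C t1) * (y t1 - b) \<le> exp (- C t1 + C t0) * (y t0 - b)"
    unfolding exp_add by (simp only: mult.assoc)
  then show ?thesis by simp
qed

lemma linear_upper_bound_half_line:
  fixes y c h :: "real \<Rightarrow> real"
  assumes "continuous_on UNIV c" and "t0 \<le> t1"
    and y: "continuous_on {t0..t1} y"
    and y': "\<And>t. t0 < t \<Longrightarrow> t < t1 \<Longrightarrow> (y has_real_derivative (- c t * y t + h t)) (at t)"
    and h: "\<And>t. t0 < t \<Longrightarrow> t < t1 \<Longrightarrow> h t \<le> c t * b"
    and "y t0 \<le> b"
  shows "y t1 \<le> b"
proof -
  obtain C where C: "\<And>t. (C has_real_derivative c t) (at t)"
    using continuous_antiderivative[OF assms(1)] by blast
  have "exp (C t0 - C t1) * (y t0 - b) \<le> 0" using \<open>y t0 \<le> b\<close> by (simp add: mult_le_0_iff)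
  then show ?thesis using linear_comparison_half_line[OF C assms(2) y y' h] by fastforce
qed

text \<open>Boundedness replaces the initial condition: the comparison started at
  \<open>t - s\<close> bounds the excess over \<open>b\<close> by a constant times
  \<open>exp (- c0 * s)\<close>, and \<open>s\<close> tends to infinity.\<close>

lemma linear_upper_bound_line:
  fixes y c h :: "real \<Rightarrow> real"
  assumes "continuous_on UNIV c" and c: "c0 > 0" "\<And>t. c0 \<le> c t"
    and y': "\<And>t. (y has_real_derivative (- c t * y t + h t)) (at t)"
    and h: "\<And>t. h t \<le> c t * b" and y: "\<And>t. y t \<le> K"
  shows "y t \<le> b"
proof -
  obtain C where C: "\<And>t. (C has_real_derivative c t) (at t)"
    using continuous_antiderivative[OF assms(1)] by blast
  have cont: "continuous_on S y" for S
    using y' by (meson DERIV_isCont continuous_at_imp_continuous_on)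
  have "y t - b \<le> exp (- c0 * s) * \<bar>K - b\<bar>" if "s \<ge> 0" for s
  proof -
    have "C (t - s) - c0 * (t - s) \<le> C t - c0 * t"
    proof (rule DERIV_nonneg_imp_nondecreasing[where f = "\<lambda>t. C t - c0 * t"])
      show "\<exists>y. ((\<lambda>t. C t - c0 * t) has_real_derivative y) (at x) \<and> 0 \<le> y" for x
        by (rule exI[of _ "c x - c0"]) (use c in \<open>auto intro!: derivative_eq_intros C\<close>)
    qed (use that in auto)
    then have *: "C (t - s) - C t \<le> - c0 * s" by (simp add: algebra_simps)
    have "y t - b \<le> exp (C (t - s) - C t) * (y (t - s) - b)"
      by (rule linear_comparison_half_line[where c = c and h = h])
         (use that C y' h cont in auto)
    also have "\<dots> \<le> exp (C (t - s) - C t) * \<bar>K - b\<bar>" using y[of "t - s"] by (intro mult_left_mono) auto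
    also have "\<dots> \<le> exp (- c0 * s) * \<bar>K - b\<bar>" using * by (intro mult_right_mono) auto
    finally show ?thesis .
  qed
  then have "\<forall>\<^sub>F s in at_top. y t - b \<le> exp (- c0 * s) * \<bar>K - b\<bar>"
    by (intro eventually_at_top_linorderI[of 0])
  moreover have "LIM s at_top. - c0 * s :> at_bot"
    by (rule filterlim_tendsto_neg_mult_at_bot[OF tendsto_const _ filterlim_ident]) (use c in simp)
  then have "((\<lambda>s. exp (- c0 * s)) \<longlongrightarrow> 0) at_top"
    by (rule filterlim_compose[OF exp_at_bot])
  then have "((\<lambda>s. exp (- c0 * s) * \<bar>K - b\<bar>) \<longlongrightarrow> 0 * \<bar>K - b\<bar>) at_top"
    by (intro tendsto_mult tendsto_const)
  ultimately have "y t - b \<le> 0 * \<bar>K - b\<bar>"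
    using tendsto_lowerbound trivial_limit_at_top_linorder by blast
  then show ?thesis by simp
qed

lemma linear_abs_bound_half_line:
  fixes y c h :: "real \<Rightarrow> real"
  assumes "continuous_on UNIV c" and "t0 \<le> t1"
    and y: "continuous_on {t0..t1} y"
    and y': "\<And>t. t0 < t \<Longrightarrow> t < t1 \<Longrightarrow> (y has_real_derivative (- c t * y t + h t)) (at t)"
    and h: "\<And>t. t0 < t \<Longrightarrow> t < t1 \<Longrightarrow> \<bar>h t\<bar> \<le> c t * b"
    and "\<bar>y t0\<bar> \<le> b"
  shows "\<bar>y t1\<bar> \<le> b"
proof -
  have "y t1 \<le> b"
    by (rule linear_upper_bound_half_line[where c = c and h = h]) (use assms in \<open>auto simp: abs_le_iff\<close>)
  moreover have "- y t1 \<le> b"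
  proof (rule linear_upper_bound_half_line[where c = c and h = "\<lambda>t. - h t" and y = "\<lambda>t. - y t"])
    show "((\<lambda>t. - y t) has_real_derivative - c t * - y t + - h t) (at t)" if "t0 < t" "t < t1" for t
      using DERIV_minus[OF y'[OF that]] by simp
  qed (use assms in \<open>auto simp: abs_le_iff intro: continuous_intros\<close>)
  ultimately show ?thesis by (simp add: abs_le_iff)
qed

lemma linear_abs_bound_line:
  fixes y c h :: "real \<Rightarrow> real"
  assumes "continuous_on UNIV c" and c: "c0 > 0" "\<And>t. c0 \<le> c t"
    and y': "\<And>t. (y has_real_derivative (- c t * y t + h t)) (at t)"
    and h: "\<And>t. \<bar>h t\<bar> \<le> c t * b" and y: "\<And>t. \<bar>y t\<bar> \<le> K"
  shows "\<bar>y t\<bar> \<le> b"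
proof -
  have "y t \<le> b"
    by (rule linear_upper_bound_line[where c = c and h = h and K = K])
       (use assms in \<open>auto simp: abs_le_iff\<close>)
  moreover have "- y t \<le> b"
  proof (rule linear_upper_bound_line[where c = c and h = "\<lambda>t. - h t" and y = "\<lambda>t. - y t" and K = K])
    show "((\<lambda>t. - y t) has_real_derivative - c t * - y t + - h t) (at t)" for t
      using DERIV_minus[OF y'] by simp
  qed (use assms in \<open>auto simp: abs_le_iff\<close>)
  ultimately show ?thesis by (simp add: abs_le_iff)
qed

lemma linear_solution_ivp:
  fixes c h :: "real \<Rightarrow> real"
  assumes "continuous_on UNIV c" "continuous_on UNIV h"
  obtains y where "\<And>t. (y has_real_derivative (- c t * y t + h t)) (at t)" "y 0 = y0"
proof -
  obtain C where C: "\<And>t. (C has_real_derivative c t) (at t)"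
    using continuous_antiderivative[OF assms(1)] by blast
  have "continuous_on UNIV C" using C by (meson DERIV_isCont continuous_at_imp_continuous_on)
  then have "continuous_on UNIV (\<lambda>t. exp (C t) * h t)" by (intro continuous_intros assms(2))
  from continuous_antiderivative[OF this]
  obtain P where P: "\<And>t. (P has_real_derivative exp (C t) * h t) (at t)" by blast
  let ?y = "\<lambda>t. exp (- C t) * (P t - (P 0 - exp (C 0) * y0))"
  show ?thesis
  proof
    show "(?y has_real_derivative (- c t * ?y t + h t)) (at t)" for t
      by (rule derivative_eq_intros C P refl)+ (simp add: algebra_simps exp_minus)
    show "?y 0 = y0" by (simp add: exp_minus)
  qed
qed

lemma linear_solution_bounded:
  fixes c h :: "real \<Rightarrow> real"
  assumes "continuous_on UNIV c" "continuous_on UNIV h"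
    and c: "c0 > 0" "\<And>t. c0 \<le> c t" and h: "\<And>t. \<bar>h t\<bar> \<le> H"
  obtains y where "\<And>t. (y has_real_derivative (- c t * y t + h t)) (at t)" "\<And>t. \<bar>y t\<bar> \<le> H / c0"
proof -
  obtain C where C: "\<And>t. (C has_real_derivative c t) (at t)"
    using continuous_antiderivative[OF assms(1)] by blast
  have "continuous_on UNIV C" using C by (meson DERIV_isCont continuous_at_imp_continuous_on)
  then have "continuous_on UNIV (\<lambda>t. exp (C t) * h t)" by (intro continuous_intros assms(2))
  from continuous_antiderivative[OF this]
  obtain P where P: "\<And>t. (P has_real_derivative exp (C t) * h t) (at t)" by blast
  \<comment> \<open>The derivative of \<open>E\<close> dominates that of \<open>P\<close> in
    absolute value, because \<open>H \<le> H / c0 * c t\<close>. Hence \<open>P + E\<close>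
    increases and \<open>P - E\<close> decreases, which pins down the constant of integration
    without an improper integral.\<close>
  define E where "E t = H / c0 * exp (C t)" for t
  have "H \<ge> 0" using h[of 0] by linarith
  have E': "(E has_real_derivative (H / c0 * c t * exp (C t))) (at t)" for t
    unfolding E_def by (rule derivative_eq_intros C refl)+ simp
  have "\<bar>h t\<bar> \<le> H / c0 * c t" for t
  proof -
    have "H * 1 \<le> H * (c t / c0)" using c \<open>H \<ge> 0\<close> by (intro mult_left_mono) (auto simp: field_simps)
    then show ?thesis using h[of t] by (simp add: field_simps)
  qed
  then have bound: "\<bar>exp (C t) * h t\<bar> \<le> H / c0 * c t * exp (C t)" for t
    using mult_right_mono[of "\<bar>h t\<bar>" "H / c0 * c t" "exp (C t)"] by (simp add: abs_mult mult_ac)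
  have up: "P s + E s \<le> P t + E t" and down: "P t - E t \<le> P s - E s" if "s \<le> t" for s t
  proof -
    show "P s + E s \<le> P t + E t"
    proof (rule DERIV_nonneg_imp_nondecreasing[OF that])
      fix x
      have "((\<lambda>t. P t + E t) has_real_derivative (exp (C x) * h x + H / c0 * c x * exp (C x))) (at x)"
        by (intro derivative_intros P E')
      then show "\<exists>y. ((\<lambda>t. P t + E t) has_real_derivative y) (at x) \<and> 0 \<le> y"
        using bound[of x] by (intro exI conjI) (assumption, linarith)
    qed
    show "P t - E t \<le> P s - E s"
    proof (rule DERIV_nonpos_imp_nonincreasing[OF that])
      fix x
      have "((\<lambda>t. P t - E t) has_real_derivative (exp (C x) * h x - H / c0 * c x * exp (C x))) (at x)"
        by (intro derivative_intros P E')
      then show "\<exists>y. ((\<lambda>t. P t - E t) has_real_derivative y) (at x) \<and> y \<le> 0"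
        using bound[of x] by (intro exI conjI) (assumption, linarith)
    qed
  qed
  have E0: "E t \<ge> 0" for t unfolding E_def using c \<open>H \<ge> 0\<close> by simp
  have sep: "P t - E t \<le> P s + E s" for s t
    using up[of s t] down[of s t] up[of t s] E0[of s] E0[of t] by (cases "s \<le> t") auto
  text \<open>\<open>L\<close> is the limit of \<open>P\<close> at \<open>-\<infinity>\<close>, so the solution below is
    \<open>\<integral> exp (C s - C t) * h s ds\<close> over \<open>s \<le> t\<close>.\<close>
  define L where "L = (INF s. P s + E s)"
  have "bdd_below (range (\<lambda>s. P s + E s))" using sep[of 0] by (intro bdd_belowI2)
  then have "L \<le> P t + E t" "P t - E t \<le> L" for t
    unfolding L_def using sep by (auto intro: cINF_lower cINF_greatest)
  then have L: "\<bar>P t - L\<bar> \<le> E t" for t by (simp add: abs_le_iff algebra_simps)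
  let ?y = "\<lambda>t. exp (- C t) * (P t - L)"
  show ?thesis
  proof
    show "(?y has_real_derivative (- c t * ?y t + h t)) (at t)" for t
      by (rule derivative_eq_intros C P refl)+ (simp add: algebra_simps exp_minus)
    show "\<bar>?y t\<bar> \<le> H / c0" for t
    proof -
      have "\<bar>?y t\<bar> \<le> exp (- C t) * E t" using L[of t] by (simp add: abs_mult)
      also have "exp (- C t) * E t = exp (- C t + C t) * (H / c0)"
        unfolding E_def exp_add by (simp add: mult_ac)
      finally show ?thesis by simp
    qed
  qed
qed

section \<open>The gain condition\<close>

text \<open>Weighted arithmetic-geometric mean inequality, from convexity of \<open>exp\<close>. The
  weights are \<open>1 / p\<close> and \<open>h k / p\<close>, and they add up to 1 because the
  \<open>h k\<close> add up to \<open>p - 1\<close>. The sums of \<open>q\<close> and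
  \<open>r\<close> being 1 means that one factor \<open>s\<close> and one factor \<open>A\<close>
  are spread over the \<open>m + 1\<close> terms.\<close>

lemma weighted_young:
  fixes x y A s p :: real and r q h :: "nat \<Rightarrow> real"
  assumes "p > 1" "x \<ge> 0" "y \<ge> 0" "A \<ge> 0" "s > 0"
    and h: "\<And>k. k \<in> {1..m} \<Longrightarrow> h k > 0" and "(\<Sum>k=1..m. h k) = p - 1"
    and "(\<Sum>k=1..m+1. q k) = 1" "(\<Sum>k=1..m+1. r k) = 1"
  shows "p * x powr (p - 1) * (A * s * y) \<le>
    A powr (p * r (m+1)) * s powr (p * q (m+1)) * y powr p +
    (\<Sum>k=1..m. h k * A powr (p * r k / h k) * s powr (p * q k / h k)) * x powr p"
    (is "_ \<le> ?R")
proof (cases "x = 0 \<or> y = 0 \<or> A = 0")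
  case True
  have "?R \<ge> 0" using h by (intro add_nonneg_nonneg mult_nonneg_nonneg sum_nonneg) (auto intro: less_imp_le)
  moreover have "p * x powr (p - 1) * (A * s * y) = 0" using True by auto
  ultimately show ?thesis by linarith
next
  case False
  then have pos: "x > 0" "y > 0" "A > 0" using assms by auto
  define w where "w k = (if k = m + 1 then 1 / p else h k / p)" for k
  \<comment> \<open>Chosen so that \<open>w k * z k\<close> is
    \<open>r k * ln A + q k * ln s\<close> plus \<open>h k * ln x\<close>, or plus
    \<open>ln y\<close> for \<open>k = m + 1\<close>. The logarithms are the reason for splitting
    off the case of a vanishing factor.\<close>
  define z where "z k = (if k = m + 1 then p * r k * ln A + p * q k * ln s + p * ln y
    else p * r k / h k * ln A + p * q k / h k * ln s + p * ln x)" for k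
  have split: "{1..m+1} = insert (m+1) {1..m}" by auto
  have "exp (\<Sum>k\<in>{1..m+1}. w k *\<^sub>R z k) \<le> (\<Sum>k\<in>{1..m+1}. w k * exp (z k))"
  proof (rule convex_on_sum[OF _ _ exp_convex])
    have "sum w {1..m+1} = 1 / p + (\<Sum>k=1..m. h k) / p"
      unfolding split by (subst sum.insert) (auto simp: w_def sum_divide_distrib intro!: sum.cong)
    also have "\<dots> = 1" using assms by (simp add: field_simps)
    finally show "sum w {1..m+1} = 1" .
    show "w k \<ge> 0" if "k \<in> {1..m+1}" for k
      using that h[of k] \<open>p > 1\<close> unfolding w_def by (auto intro: less_imp_le)
  qed auto
  moreover have "(\<Sum>k\<in>{1..m+1}. w k *\<^sub>R z k) = (p - 1) * ln x + ln A + ln s + ln y"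
  proof -
    have "(\<Sum>k\<in>{1..m}. w k *\<^sub>R z k) = (\<Sum>k\<in>{1..m}. r k * ln A + q k * ln s + h k * ln x)"
    proof (rule sum.cong[OF refl])
      fix k assume k: "k \<in> {1..m}"
      then show "w k *\<^sub>R z k = r k * ln A + q k * ln s + h k * ln x"
        using h[OF k] \<open>p > 1\<close> by (simp add: w_def z_def field_simps)
    qed
    also have "\<dots> = (\<Sum>k=1..m. r k) * ln A + (\<Sum>k=1..m. q k) * ln s + (p - 1) * ln x"
      using assms by (simp add: sum.distrib flip: sum_distrib_right)
    finally have "(\<Sum>k\<in>{1..m+1}. w k *\<^sub>R z k) = w (m+1) * z (m+1) +
      ((\<Sum>k=1..m. r k) * ln A + (\<Sum>k=1..m. q k) * ln s + (p - 1) * ln x)"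
      unfolding split by (subst sum.insert) auto
    also have "w (m+1) * z (m+1) = r (m+1) * ln A + q (m+1) * ln s + ln y"
      using \<open>p > 1\<close> by (simp add: w_def z_def field_simps)
    also have "r (m+1) * ln A + q (m+1) * ln s + ln y +
      ((\<Sum>k=1..m. r k) * ln A + (\<Sum>k=1..m. q k) * ln s + (p - 1) * ln x) =
      (\<Sum>k=1..m+1. r k) * ln A + (\<Sum>k=1..m+1. q k) * ln s + ln y + (p - 1) * ln x"
      unfolding split by (subst (1 2) sum.insert) (auto simp: algebra_simps)
    finally show ?thesis using assms by simp
  qed
  moreover have "exp ((p - 1) * ln x + ln A + ln s + ln y) = x powr (p - 1) * (A * s * y)"
    using pos \<open>s > 0\<close> by (simp add: exp_add powr_def)
  moreover have "p * (\<Sum>k\<in>{1..m+1}. w k * exp (z k)) = ?R"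
  proof -
    have "p * (\<Sum>k\<in>{1..m+1}. w k * exp (z k)) =
      p * (w (m+1) * exp (z (m+1))) + (\<Sum>k=1..m. p * (w k * exp (z k)))"
      unfolding split by (subst sum.insert) (auto simp: distrib_left sum_distrib_left)
    also have "p * (w (m+1) * exp (z (m+1))) = A powr (p * r (m+1)) * s powr (p * q (m+1)) * y powr p"
      using pos \<open>s > 0\<close> \<open>p > 1\<close> by (simp add: w_def z_def exp_add powr_def)
    also have "(\<Sum>k=1..m. p * (w k * exp (z k))) =
      (\<Sum>k=1..m. h k * A powr (p * r k / h k) * s powr (p * q k / h k) * x powr p)"
      using pos \<open>s > 0\<close> \<open>p > 1\<close>
      by (intro sum.cong) (auto simp: w_def z_def exp_add powr_def)
    finally show ?thesis by (simp add: sum_distrib_right)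
  qed
  moreover have "p > 0" using \<open>p > 1\<close> by simp
  ultimately show ?thesis
    by (metis mult.assoc mult_le_cancel_left_pos)
qed

text \<open>Row \<open>i\<close> of the cone inequality is multiplied by
  \<open>p * d i * w i powr (p - 1)\<close>, bounded by \<open>weighted_young\<close>, and summed
  over \<open>i\<close>. After an exchange of indices the coefficient of \<open>w i powr p\<close>
  is the double sum in the gain condition, so a nonzero \<open>w i\<close> gives a strict
  contradiction.\<close>

lemma gain_no_fixed_cone:
  fixes A :: "'n::finite \<Rightarrow> 'n \<Rightarrow> 'm::finite \<Rightarrow> real" and c0 s d w :: "'n \<Rightarrow> real"
    and q r :: "'n \<Rightarrow> 'm \<Rightarrow> nat \<Rightarrow> real" and h :: "nat \<Rightarrow> real" and p :: real
  assumes "p > 1" and A: "\<And>i j l. A i j l \<ge> 0" and s: "\<And>i. s i > 0" and d: "\<And>i. d i > 0"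
    and h: "\<And>k. k \<in> {1..m} \<Longrightarrow> h k > 0" and hs: "(\<Sum>k=1..m. h k) = p - 1"
    and q: "\<And>j l. (\<Sum>k=1..m+1. q j l k) = 1" and r: "\<And>j l. (\<Sum>k=1..m+1. r j l k) = 1"
    and gain: "\<And>i. p * d i * c0 i >
      (\<Sum>l\<in>UNIV. \<Sum>j\<in>UNIV.
         d j * A j i l powr (p * r i l (m+1)) * s i powr (p * q i l (m+1)) +
         (\<Sum>k=1..m. d i * h k * A i j l powr (p * r j l k / h k) * s j powr (p * q j l k / h k)))"
    and w: "\<And>i. w i \<ge> 0" and cone: "\<And>i. c0 i * w i \<le> (\<Sum>l\<in>UNIV. \<Sum>j\<in>UNIV. A i j l * s j * w j)"
  shows "w i = 0"
proof (rule ccontr)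
  assume "w i \<noteq> 0"
  define U where "U j i l = d j * A j i l powr (p * r i l (m+1)) * s i powr (p * q i l (m+1))" for j i l
  define V where "V i j l = (\<Sum>k=1..m. d i * h k * A i j l powr (p * r j l k / h k) * s j powr (p * q j l k / h k))" for i j l
  have gain': "(\<Sum>l\<in>UNIV. \<Sum>j\<in>UNIV. U j i l + V i j l) < p * d i * c0 i" for i
    using gain[of i] unfolding U_def V_def .
  have pw: "w i powr p = w i powr (p - 1) * w i" for i
    using w[of i] powr_mult_base[of "w i" "p - 1"] by (cases "w i = 0") (auto simp: mult.commute)
  have row: "p * d i * c0 i * w i powr p \<le>
    (\<Sum>l\<in>UNIV. \<Sum>j\<in>UNIV. U i j l * w j powr p + V i j l * w i powr p)" for i
  proof -
    have "p * d i * c0 i * w i powr p = p * d i * w i powr (p - 1) * (c0 i * w i)"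
      by (simp add: pw mult_ac)
    also have "\<dots> \<le> p * d i * w i powr (p - 1) * (\<Sum>l\<in>UNIV. \<Sum>j\<in>UNIV. A i j l * s j * w j)"
      using \<open>p > 1\<close> d[of i] by (intro mult_left_mono cone mult_nonneg_nonneg) auto
    also have "\<dots> = (\<Sum>l\<in>UNIV. \<Sum>j\<in>UNIV. d i * (p * w i powr (p - 1) * (A i j l * s j * w j)))"
      by (simp add: sum_distrib_left mult_ac)
    also have "\<dots> \<le> (\<Sum>l\<in>UNIV. \<Sum>j\<in>UNIV. U i j l * w j powr p + V i j l * w i powr p)"
    proof (intro sum_mono)
      fix l j
      have "d i * (p * w i powr (p - 1) * (A i j l * s j * w j)) \<le> d i *
        (A i j l powr (p * r j l (m+1)) * s j powr (p * q j l (m+1)) * w j powr p +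
        (\<Sum>k=1..m. h k * A i j l powr (p * r j l k / h k) * s j powr (p * q j l k / h k)) * w i powr p)"
        using d[of i] by (intro mult_left_mono weighted_young assms) auto
      also have "\<dots> = U i j l * w j powr p + V i j l * w i powr p"
        by (simp add: U_def V_def distrib_left sum_distrib_left sum_distrib_right mult_ac)
      finally show "d i * (p * w i powr (p - 1) * (A i j l * s j * w j)) \<le> U i j l * w j powr p + V i j l * w i powr p" .
    qed
    finally show ?thesis .
  qed
  have "(\<Sum>i\<in>UNIV. p * d i * c0 i * w i powr p) \<le>
    (\<Sum>i\<in>UNIV. \<Sum>l\<in>UNIV. \<Sum>j\<in>UNIV. U i j l * w j powr p + V i j l * w i powr p)"
    by (intro sum_mono row)
  also have "\<dots> = (\<Sum>i\<in>UNIV. \<Sum>l\<in>UNIV. \<Sum>j\<in>UNIV. U i j l * w j powr p) +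
    (\<Sum>i\<in>UNIV. \<Sum>l\<in>UNIV. \<Sum>j\<in>UNIV. V i j l * w i powr p)" by (simp add: sum.distrib)
  also have "(\<Sum>i\<in>UNIV. \<Sum>l\<in>UNIV. \<Sum>j\<in>UNIV. U i j l * w j powr p) =
    (\<Sum>l\<in>UNIV. \<Sum>i\<in>UNIV. \<Sum>j\<in>UNIV. U i j l * w j powr p)" by (rule sum.swap)
  \<comment> \<open>The two neuron indices trade places, which produces the weight
    \<open>d j\<close> and the transposed coefficient \<open>A j i l\<close> of the gain
    condition.\<close>
  also have "\<dots> = (\<Sum>l\<in>UNIV. \<Sum>i\<in>UNIV. \<Sum>j\<in>UNIV. U j i l * w i powr p)"
    by (rule sum.cong[OF refl], rule sum.swap)
  also have "\<dots> = (\<Sum>i\<in>UNIV. \<Sum>l\<in>UNIV. \<Sum>j\<in>UNIV. U j i l * w i powr p)" by (rule sum.swap)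
  also have "\<dots> + (\<Sum>i\<in>UNIV. \<Sum>l\<in>UNIV. \<Sum>j\<in>UNIV. V i j l * w i powr p) =
    (\<Sum>i\<in>UNIV. (\<Sum>l\<in>UNIV. \<Sum>j\<in>UNIV. U j i l + V i j l) * w i powr p)"
    by (simp add: sum.distrib sum_distrib_right distrib_right)
  also have "\<dots> < (\<Sum>i\<in>UNIV. p * d i * c0 i * w i powr p)"
  proof (rule sum_strict_mono_ex1)
    show "\<forall>i\<in>UNIV. (\<Sum>l\<in>UNIV. \<Sum>j\<in>UNIV. U j i l + V i j l) * w i powr p \<le> p * d i * c0 i * w i powr p"
      using gain' by (intro ballI mult_right_mono) (auto intro: less_imp_le)
    show "\<exists>i\<in>UNIV. (\<Sum>l\<in>UNIV. \<Sum>j\<in>UNIV. U j i l + V i j l) * w i powr p < p * d i * c0 i * w i powr p"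
      using gain' \<open>w i \<noteq> 0\<close> by (intro bexI[of _ i] mult_strict_right_mono) auto
  qed simp
  finally show False by simp
qed

text \<open>The absolute values of a kernel vector of \<open>f\<close> satisfy the cone inequality,
  so \<open>f\<close> is injective, hence onto, and \<open>\<xi>\<close> is taken as the preimage of
  the vector of ones. Its negative part satisfies the cone inequality too and vanishes; the equation
  \<open>c0 i * \<xi> $ i = 1 + ...\<close> then makes every entry positive.\<close>

lemma nonneg_matrix_positive_supersolution:
  fixes K :: "real ^ 'n::finite ^ 'n" and c0 :: "'n \<Rightarrow> real"
  assumes K: "\<And>i j. K $ i $ j \<ge> 0" and c0: "\<And>i. c0 i > 0"
    and inj: "\<And>w. (\<And>i. w $ i \<ge> 0) \<Longrightarrow> (\<And>i. c0 i * w $ i \<le> (K *v w) $ i) \<Longrightarrow> w = 0"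
  obtains \<xi> where "\<And>i. \<xi> $ i > 0" "\<And>i. (K *v \<xi>) $ i < c0 i * \<xi> $ i"
proof -
  define f where "f v = (\<chi> i. c0 i * v $ i) - K *v v" for v
  have lin: "linear f"
    unfolding f_def
    by (intro linear_compose_sub matrix_vector_mul_linear)
       (auto intro!: linearI simp: vec_eq_iff algebra_simps)
  have "inj f"
  proof (subst linear_injective_0[OF lin], intro allI impI)
    fix v assume v: "f v = 0"
    have "c0 i * \<bar>v $ i\<bar> \<le> (K *v (\<chi> i. \<bar>v $ i\<bar>)) $ i" for i
    proof -
      have "c0 i * v $ i = (\<Sum>j\<in>UNIV. K $ i $ j * v $ j)"
        using v by (simp add: f_def vec_eq_iff matrix_vector_mult_def)
      then have "c0 i * \<bar>v $ i\<bar> = \<bar>\<Sum>j\<in>UNIV. K $ i $ j * v $ j\<bar>"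
        using c0[of i] by (metis abs_mult abs_of_pos)
      also have "\<dots> \<le> (\<Sum>j\<in>UNIV. \<bar>K $ i $ j * v $ j\<bar>)" by (rule sum_abs)
      finally show ?thesis using K by (simp add: matrix_vector_mult_def abs_mult)
    qed
    then have "(\<chi> i. \<bar>v $ i\<bar>) = 0" by (intro inj) auto
    then show "v = 0" by (simp add: vec_eq_iff)
  qed
  then have "surj f" by (rule linear_inj_imp_surj[OF lin])
  then obtain \<xi> where \<xi>: "f \<xi> = (\<chi> i. 1)" by (metis surjD)
  have eq: "c0 i * \<xi> $ i = 1 + (\<Sum>j\<in>UNIV. K $ i $ j * \<xi> $ j)" for i
  proof -
    have "f \<xi> $ i = 1" using \<xi> by simp
    then show ?thesis by (simp add: f_def matrix_vector_mult_def algebra_simps)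
  qed
  have "c0 i * max 0 (- \<xi> $ i) \<le> (K *v (\<chi> i. max 0 (- \<xi> $ i))) $ i" for i
  proof -
    have neg: "(\<Sum>j\<in>UNIV. K $ i $ j * - \<xi> $ j) \<le> (\<Sum>j\<in>UNIV. K $ i $ j * max 0 (- \<xi> $ j))"
      using K by (intro sum_mono mult_left_mono) auto
    have "0 \<le> (\<Sum>j\<in>UNIV. K $ i $ j * max 0 (- \<xi> $ j))"
      using K by (intro sum_nonneg mult_nonneg_nonneg) auto
    then show ?thesis
      using neg eq[of i] by (simp add: matrix_vector_mult_def sum_negf max_def)
  qed
  then have z: "(\<chi> i. max 0 (- \<xi> $ i)) = 0" by (intro inj) auto
  have "\<xi> $ i \<ge> 0" for i
  proof -
    have "(\<chi> i. max 0 (- \<xi> $ i)) $ i = 0" unfolding z by simp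
    then show ?thesis by simp
  qed
  then have "(\<Sum>j\<in>UNIV. K $ i $ j * \<xi> $ j) \<ge> 0" for i using K by (intro sum_nonneg mult_nonneg_nonneg)
  then have "c0 i * \<xi> $ i > 0" for i unfolding eq by (simp add: add_pos_nonneg)
  then have "\<xi> $ i > 0" for i using c0[of i] by (metis zero_less_mult_pos)
  then show ?thesis by (rule that) (use eq in \<open>simp add: matrix_vector_mult_def\<close>)
qed

section \<open>Contractions in a weighted supremum norm\<close>

text \<open>\<open>step\<close> improves an arbitrary upper bound; applied to the supremum it reads
  \<open>D \<le> \<theta> * D + e\<close>. Uniqueness is the case \<open>e = 0\<close>, and for
  almost periodicity \<open>e\<close> measures the perturbation caused by a translation.\<close>

lemma contraction_bound:
  fixes f :: "'a \<Rightarrow> real"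
  assumes "\<And>x. f x \<le> M" and "\<theta> < 1"
    and step: "\<And>D x. (\<And>x. f x \<le> D) \<Longrightarrow> f x \<le> \<theta> * D + e"
  shows "f x \<le> e / (1 - \<theta>)"
proof -
  define D where "D = (SUP x. f x)"
  have le: "f x \<le> D" for x unfolding D_def using assms(1) by (intro cSUP_upper bdd_aboveI2) auto
  have "D \<le> \<theta> * D + e" unfolding D_def
    by (rule cSUP_least) (use step[OF le] in \<open>auto simp: D_def\<close>)
  then have "D \<le> e / (1 - \<theta>)" using \<open>\<theta> < 1\<close> by (simp add: field_simps)
  then show ?thesis using le[of x] by linarith
qed

text \<open>Banach's fixed point theorem with the solution operator as a relation \<open>R\<close>:
  a choice function \<open>T\<close> is extracted, and \<open>contr\<close> compares any two related
  pairs. The constraint set \<open>Y i t\<close> depends on time so that singletons can prescribe an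
  initial history.\<close>

lemma weighted_picard:
  fixes R :: "('n::finite \<Rightarrow> real \<Rightarrow> real) \<Rightarrow> ('n \<Rightarrow> real \<Rightarrow> real) \<Rightarrow> bool"
  assumes X: "X = {u. (\<forall>i. continuous_on UNIV (u i)) \<and> (\<forall>i t. u i t \<in> Y i t)}"
    and Y: "\<And>i t. closed (Y i t)" "\<And>i t. Y i t \<subseteq> {- M..M}"
    and ne: "u0 \<in> X" and ex: "\<And>u. u \<in> X \<Longrightarrow> \<exists>v\<in>X. R u v"
    and \<theta>: "0 \<le> \<theta>" "\<theta> < 1" and \<xi>: "\<And>i. \<xi> i > 0"
    and contr: "\<And>u v u' v' D. u \<in> X \<Longrightarrow> v \<in> X \<Longrightarrow> u' \<in> X \<Longrightarrow> v' \<in> X \<Longrightarrow> R u v \<Longrightarrow> R u' v' \<Longrightarrow> D \<ge> 0 \<Longrightarrow>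
      (\<And>i t. \<bar>u i t - u' i t\<bar> \<le> D * \<xi> i) \<Longrightarrow> (\<And>i t. \<bar>v i t - v' i t\<bar> \<le> \<theta> * D * \<xi> i)"
  shows "\<exists>u\<in>X. R u u"
proof -
  obtain T where T: "\<And>u. u \<in> X \<Longrightarrow> T u \<in> X" "\<And>u. u \<in> X \<Longrightarrow> R u (T u)" using ex by metis
  define s where "s n = (T ^^ n) u0" for n
  have s: "s n \<in> X" "s (Suc n) = T (s n)" for n
    unfolding s_def by (induction n) (auto simp: ne T)
  have bd: "\<bar>u i t\<bar> \<le> M" if "u \<in> X" for u i t
  proof -
    have "u i t \<in> {- M..M}" using that Y(2)[of i t] unfolding X by blast
    then show ?thesis by auto
  qed
  \<comment> \<open>Two members of \<open>X\<close> differ by at most \<open>2 * M\<close>, and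
    \<open>D\<close> is large enough to express this in the norm weighted by
    \<open>\<xi>\<close>.\<close>
  define D where "D = (\<Sum>i\<in>UNIV. 2 * M / \<xi> i)"
  have "M \<ge> 0" using bd[OF ne] abs_ge_zero order_trans by blast
  have "2 * M / \<xi> i \<le> D" for i
    unfolding D_def using \<open>M \<ge> 0\<close> less_imp_le[OF \<xi>]
    by (intro member_le_sum divide_nonneg_nonneg) auto
  then have D: "2 * M \<le> D * \<xi> i" for i using \<xi> by (simp add: pos_divide_le_eq)
  have "D \<ge> 0" unfolding D_def using \<open>M \<ge> 0\<close> \<xi> by (intro sum_nonneg divide_nonneg_nonneg) (auto intro: less_imp_le)
  have step: "\<bar>s (Suc n) i t - s n i t\<bar> \<le> D * \<theta> ^ n * \<xi> i" for n i t
  proof (induction n arbitrary: i t)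
    case 0
    show ?case using bd[OF s(1)[of 0], of i t] bd[OF s(1)[of 1], of i t] D[of i] by simp
  next
    case (Suc n)
    have sR: "R (s n) (s (Suc n))" for n unfolding s(2) by (rule T(2)[OF s(1)])
    have "\<bar>s (Suc (Suc n)) i t - s (Suc n) i t\<bar> \<le> \<theta> * (D * \<theta> ^ n) * \<xi> i"
      by (rule contr[OF s(1) s(1) s(1) s(1) sR sR _ Suc]) (use \<theta> \<open>D \<ge> 0\<close> in simp)
    then show ?case by (simp add: mult_ac)
  qed
  have tele: "\<bar>s (n + k) i t - s n i t\<bar> \<le> D * \<xi> i / (1 - \<theta>) * \<theta> ^ n" for n k i t
  proof -
    have "\<bar>s (n + k) i t - s n i t\<bar> \<le> (\<Sum>m<k. D * \<theta> ^ (n + m) * \<xi> i)"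
    proof (induction k)
      case (Suc k)
      then show ?case using step[of "n + k" i t] by simp
    qed simp
    also have "\<dots> = D * \<xi> i * \<theta> ^ n * (\<Sum>m<k. \<theta> ^ m)"
      by (simp add: sum_distrib_left power_add mult_ac)
    also have "(\<Sum>m<k. \<theta> ^ m) \<le> 1 / (1 - \<theta>)"
      using \<theta> by (simp add: sum_gp_strict divide_right_mono)
    then have "D * \<xi> i * \<theta> ^ n * (\<Sum>m<k. \<theta> ^ m) \<le> D * \<xi> i * \<theta> ^ n * (1 / (1 - \<theta>))"
      using \<open>D \<ge> 0\<close> \<xi>[of i] \<theta> by (intro mult_left_mono) auto
    finally show ?thesis by simp
  qed
  have rate: "(\<lambda>n. D * \<xi> i / (1 - \<theta>) * \<theta> ^ n) \<longlonglongrightarrow> 0" for i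
    using tendsto_mult[OF tendsto_const LIMSEQ_power_zero[of \<theta>]] \<theta> by fastforce
  have "Cauchy (\<lambda>n. s n i t)" for i t
  proof (rule metric_CauchyI)
    fix e :: real assume "e > 0"
    then obtain N where N: "\<And>n. n \<ge> N \<Longrightarrow> D * \<xi> i / (1 - \<theta>) * \<theta> ^ n < e / 2"
      using order_tendstoD(2)[OF rate, of "e / 2" i] by (auto simp: eventually_sequentially)
    have "\<bar>s m i t - s N i t\<bar> < e / 2" if "m \<ge> N" for m
    proof -
      have "\<bar>s m i t - s N i t\<bar> \<le> D * \<xi> i / (1 - \<theta>) * \<theta> ^ N" using tele[of N "m - N" i t] that by simp
      also have "\<dots> < e / 2" by (rule N) simp
      finally show ?thesis .
    qed
    then show "\<exists>N. \<forall>m\<ge>N. \<forall>n\<ge>N. dist (s m i t) (s n i t) < e"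
      by (intro exI[of _ N]) (metis abs_minus_commute dist_real_def dist_triangle_half_r)
  qed
  then have "\<exists>x. (\<lambda>n. s n i t) \<longlonglongrightarrow> x" for i t
    by (simp add: Cauchy_convergent_iff convergent_def)
  then obtain u where u: "\<And>i t. (\<lambda>n. s n i t) \<longlonglongrightarrow> u i t" by metis
  have dist_u: "\<bar>u i t - s n i t\<bar> \<le> D * \<xi> i / (1 - \<theta>) * \<theta> ^ n" for n i t
  proof (rule tendsto_upperbound)
    show "(\<lambda>k. \<bar>s (n + k) i t - s n i t\<bar>) \<longlonglongrightarrow> \<bar>u i t - s n i t\<bar>"
      using LIMSEQ_ignore_initial_segment[OF u[of i t], of n]
      by (intro tendsto_intros) (simp add: add.commute)
  qed (use tele in auto)
  have "u \<in> X"
    unfolding X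
  proof (intro CollectI conjI allI)
    fix i
    have "uniform_limit UNIV (\<lambda>n. s n i) (u i) sequentially"
    proof (rule uniform_limitI)
      fix e :: real assume "e > 0"
      then have "\<forall>\<^sub>F n in sequentially. D * \<xi> i / (1 - \<theta>) * \<theta> ^ n < e"
        using order_tendstoD(2)[OF rate] by blast
      then show "\<forall>\<^sub>F n in sequentially. \<forall>x\<in>UNIV. dist (s n i x) (u i x) < e"
      proof eventually_elim
        case (elim n)
        then show ?case using dist_u[of i _ n] by (metis abs_minus_commute dist_real_def le_less_trans)
      qed
    qed
    then show "continuous_on UNIV (u i)"
      by (rule uniform_limit_theorem[rotated]) (use s(1) in \<open>auto simp: X\<close>)
    show "u i t \<in> Y i t" for t
      by (rule closed_sequentially[OF Y(1) _ u]) (use s(1) in \<open>auto simp: X\<close>)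
  qed
  \<comment> \<open>\<open>contr\<close> compares the limit with the iterates as well, so
    \<open>s (Suc n) = T (s n)\<close> converges to \<open>T u\<close> and to
    \<open>u\<close>.\<close>
  have "T u i t = u i t" for i t
  proof -
    have "\<bar>T u i t - s (Suc n) i t\<bar> \<le> \<theta> * (D / (1 - \<theta>) * \<theta> ^ n) * \<xi> i" for n
      unfolding s(2)
      by (rule contr[OF \<open>u \<in> X\<close> T(1)[OF \<open>u \<in> X\<close>] s(1) T(1)[OF s(1)] T(2)[OF \<open>u \<in> X\<close>] T(2)[OF s(1)]])
         (use dist_u \<theta> \<open>D \<ge> 0\<close> in \<open>auto simp: mult_ac\<close>)
    then have "\<bar>s (Suc n) i t - T u i t\<bar> \<le> D * \<xi> i / (1 - \<theta>) * \<theta> ^ Suc n" for n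
      by (simp add: abs_minus_commute mult_ac)
    then have "\<forall>\<^sub>F n in sequentially. norm (s (Suc n) i t - T u i t) \<le> D * \<xi> i / (1 - \<theta>) * \<theta> ^ Suc n"
      unfolding real_norm_def by (intro always_eventually allI)
    then have "(\<lambda>n. s (Suc n) i t - T u i t) \<longlonglongrightarrow> 0"
      by (rule Lim_null_comparison[OF _ LIMSEQ_Suc[OF rate]])
    then have "(\<lambda>n. s (Suc n) i t) \<longlonglongrightarrow> T u i t" by (rule LIM_zero_cancel)
    then show ?thesis using LIMSEQ_Suc[OF u] LIMSEQ_unique by blast
  qed
  then have "T u = u" by blast
  then show ?thesis using \<open>u \<in> X\<close> T by metis
qed

text \<open>The method of steps: going back from \<open>t\<close> to \<open>r\<close> lowers the
  number of steps of length \<open>\<delta>\<close> above \<open>lo\<close> by at least one, and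
  that number is the induction measure.\<close>

lemma delay_induct:
  fixes \<delta> lo :: real
  assumes "\<delta> > 0" and "\<And>t. Q t \<Longrightarrow> (\<And>r. Q r \<Longrightarrow> r \<le> t - \<delta> \<Longrightarrow> P r) \<Longrightarrow> P t"
    and "\<And>t. Q t \<Longrightarrow> lo \<le> t" and "Q t"
  shows "P t"
  using assms(4)
proof (induction "nat \<lceil>(t - lo) / \<delta>\<rceil>" arbitrary: t rule: less_induct)
  case less
  show ?case
  proof (rule assms(2)[OF less.prems])
    fix r assume r: "Q r" "r \<le> t - \<delta>"
    have "(r - lo) / \<delta> \<le> (t - lo) / \<delta> - 1" "0 \<le> (r - lo) / \<delta>"
      using r assms(1) assms(3)[OF r(1)] by (auto simp: field_simps)
    then have "nat \<lceil>(r - lo) / \<delta>\<rceil> < nat \<lceil>(t - lo) / \<delta>\<rceil>" by linarith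
    then show "P r" using less.hyps r(1) by blast
  qed
qed

section \<open>Networks with an invariant sector\<close>

text \<open>Everything on the right-hand side except the decay term. The index precedes the time, so
  that each component is a plain function of time.\<close>

definition forcing ::
  "('n::finite \<Rightarrow> 'n \<Rightarrow> 'm::finite \<Rightarrow> real \<Rightarrow> real) \<Rightarrow> ('n \<Rightarrow> real \<Rightarrow> real) \<Rightarrow> ('n \<Rightarrow> real) \<Rightarrow>
   ('n \<Rightarrow> 'n \<Rightarrow> 'm \<Rightarrow> real \<Rightarrow> real) \<Rightarrow> ('n \<Rightarrow> real \<Rightarrow> real) \<Rightarrow> ('n \<Rightarrow> real \<Rightarrow> real) \<Rightarrow> 'n \<Rightarrow> real \<Rightarrow> real" where
  "forcing a g \<sigma> \<tau> J u i t =
     (\<Sum>l\<in>UNIV. \<Sum>j\<in>UNIV. a i j l t * g j (\<sigma> j * u j (t - \<tau> i j l t))) + J i t"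

lemma abs_le_history_norm:
  assumes "\<And>i. continuous_on {-k..0} (\<lambda>s. \<phi> s $ i)" "s \<in> {-k..0}"
  shows "\<bar>\<phi> s $ i\<bar> \<le> history_norm k \<phi>"
proof -
  have "bdd_above ((\<lambda>s. \<bar>\<phi> s $ i\<bar>) ` {-k..0})"
    by (intro bounded_imp_bdd_above compact_imp_bounded compact_continuous_image
        continuous_intros assms(1) compact_Icc)
  then have "\<bar>\<phi> s $ i\<bar> \<le> (SUP s\<in>{-k..0}. \<bar>\<phi> s $ i\<bar>)" by (rule cSUP_upper[OF assms(2)])
  also have "\<dots> \<le> history_norm k \<phi>" unfolding history_norm_def by (intro Max_ge) auto
  finally show ?thesis .
qed

lemma gnn_rhs_forcing:
  "gnn_rhs c a g \<sigma> \<tau> J U t i = - c i t * U t $ i + forcing a g \<sigma> \<tau> J (\<lambda>i t. U t $ i) i t"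
  by (simp add: gnn_rhs_def forcing_def)

text \<open>The sector is \<open>{x. \<forall>i. e i * x i \<le> b i}\<close> with signs \<open>e i\<close>, so that both kinds of basin
  components are upper bounds.\<close>

locale gnn_sector =
  fixes c :: "'n::finite \<Rightarrow> real \<Rightarrow> real"
    and a :: "'n \<Rightarrow> 'n \<Rightarrow> 'm::finite \<Rightarrow> real \<Rightarrow> real"
    and g :: "'n \<Rightarrow> real \<Rightarrow> real" and \<sigma> :: "'n \<Rightarrow> real"
    and \<tau> :: "'n \<Rightarrow> 'n \<Rightarrow> 'm \<Rightarrow> real \<Rightarrow> real" and J :: "'n \<Rightarrow> real \<Rightarrow> real"
    and k :: real and A :: "'n \<Rightarrow> 'n \<Rightarrow> 'm \<Rightarrow> real" and B c0 s \<xi> e b :: "'n \<Rightarrow> real"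
  assumes ap_c: "\<And>i. almost_periodic (c i)" and ap_a: "\<And>i j l. almost_periodic (a i j l)"
    and ap_\<tau>: "\<And>i j l. almost_periodic (\<tau> i j l)" and ap_J: "\<And>i. almost_periodic (J i)"
    and g_cont: "\<And>j. continuous_on UNIV (g j)" and g_le: "\<And>j x. \<bar>g j x\<bar> \<le> B j"
    and c0_pos: "\<And>i. c0 i > 0" and c0_le: "\<And>i t. c0 i \<le> c i t"
    and a_le: "\<And>i j l t. \<bar>a i j l t\<bar> \<le> A i j l"
    and \<tau>_pos: "\<And>i j l t. \<tau> i j l t > 0" and \<tau>_le: "\<And>i j l t. \<tau> i j l t \<le> k"
    and sign: "\<And>i. e i = 1 \<or> e i = -1"
    and s_nonneg: "\<And>j. s j \<ge> 0"
    and g_lip: "\<And>j x y. e j * x \<le> b j \<Longrightarrow> e j * y \<le> b j \<Longrightarrow> \<bar>g j (\<sigma> j * x) - g j (\<sigma> j * y)\<bar> \<le> s j * \<bar>x - y\<bar>"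
    and \<xi>_pos: "\<And>i. \<xi> i > 0"
    and gain: "\<And>i. (\<Sum>l\<in>UNIV. \<Sum>j\<in>UNIV. A i j l * s j * \<xi> j) < c0 i * \<xi> i"
    and sector: "\<And>u i t. (\<And>j l. e j * u j (t - \<tau> i j l t) \<le> b j) \<Longrightarrow> e i * forcing a g \<sigma> \<tau> J u i t \<le> c i t * b i"
begin

abbreviation "F \<equiv> forcing a g \<sigma> \<tau> J"

abbreviation "G i \<equiv> \<Sum>l\<in>UNIV. \<Sum>j\<in>UNIV. A i j l * s j * \<xi> j"

definition "in_sector u t \<longleftrightarrow> (\<forall>i. e i * u i t \<le> b i)"

text \<open>\<open>u\<close> enters the delayed terms and \<open>v\<close> is the unknown, so fixed
  points are the solutions of the network. \<open>W\<close> will be the whole line or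
  \<open>{0..}\<close>; on the latter the derivative at 0 is one-sided.\<close>

definition solves :: "real set \<Rightarrow> ('n \<Rightarrow> real \<Rightarrow> real) \<Rightarrow> ('n \<Rightarrow> real \<Rightarrow> real) \<Rightarrow> bool" where
  "solves W u v \<longleftrightarrow> (\<forall>i. \<forall>t\<in>W. (v i has_real_derivative (- c i t * v i t + F u i t)) (at t within W))"

section \<open>Bounds for the forcing term and the contraction factor\<close>

lemma A_nonneg: "A i j l \<ge> 0"
  using a_le[of i j l 0] by linarith

lemma B_nonneg: "B j \<ge> 0"
  using g_le[of j 0] by linarith

lemma G_nonneg: "G i \<ge> 0"
  by (intro sum_nonneg mult_nonneg_nonneg A_nonneg s_nonneg less_imp_le[OF \<xi>_pos])

lemma k_pos: "k > 0"
  using \<tau>_pos \<tau>_le by (meson less_le_trans)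

lemma c_cont: "continuous_on UNIV (c i)"
  by (rule almost_periodic_continuous[OF ap_c])

text \<open>The hypotheses concern the delayed times only, so that functions controlled merely from
  \<open>- k\<close> on are covered too.\<close>

lemma forcing_diff:
  assumes "\<And>j l. in_sector u (t - \<tau> i j l t)" "\<And>j l. in_sector v (t - \<tau> i j l t)"
    and D: "\<And>j l. \<bar>u j (t - \<tau> i j l t) - v j (t - \<tau> i j l t)\<bar> \<le> D * \<xi> j"
  shows "\<bar>F u i t - F v i t\<bar> \<le> D * G i"
proof -
  have "\<bar>F u i t - F v i t\<bar> = \<bar>\<Sum>l\<in>UNIV. \<Sum>j\<in>UNIV.
    a i j l t * (g j (\<sigma> j * u j (t - \<tau> i j l t)) - g j (\<sigma> j * v j (t - \<tau> i j l t)))\<bar>"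
    by (simp add: forcing_def right_diff_distrib sum_subtractf)
  also have "\<dots> \<le> (\<Sum>l\<in>UNIV. \<Sum>j\<in>UNIV.
    \<bar>a i j l t * (g j (\<sigma> j * u j (t - \<tau> i j l t)) - g j (\<sigma> j * v j (t - \<tau> i j l t)))\<bar>)"
    by (rule order_trans[OF sum_abs]) (intro sum_mono sum_abs)
  also have "\<dots> \<le> (\<Sum>l\<in>UNIV. \<Sum>j\<in>UNIV. A i j l * (s j * (D * \<xi> j)))"
  proof (intro sum_mono)
    fix l j
    have "\<bar>g j (\<sigma> j * u j (t - \<tau> i j l t)) - g j (\<sigma> j * v j (t - \<tau> i j l t))\<bar> \<le>
      s j * \<bar>u j (t - \<tau> i j l t) - v j (t - \<tau> i j l t)\<bar>"
      using assms(1,2) by (intro g_lip) (auto simp: in_sector_def)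
    also have "\<dots> \<le> s j * (D * \<xi> j)" by (intro mult_left_mono D s_nonneg)
    finally show "\<bar>a i j l t * (g j (\<sigma> j * u j (t - \<tau> i j l t)) - g j (\<sigma> j * v j (t - \<tau> i j l t)))\<bar> \<le>
      A i j l * (s j * (D * \<xi> j))"
      unfolding abs_mult by (intro mult_mono a_le A_nonneg) auto
  qed
  also have "\<dots> = D * G i" by (simp add: sum_distrib_left mult_ac)
  finally show ?thesis .
qed

lemma forcing_bounded:
  obtains H where "H \<ge> 0" "\<And>u i t. \<bar>F u i t\<bar> \<le> H"
proof -
  have "\<exists>K. \<forall>t. \<bar>J i t\<bar> \<le> K" for i using almost_periodic_bounded[OF ap_J] by metis
  then obtain K where K: "\<And>i t. \<bar>J i t\<bar> \<le> K i" by metis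
  have K0: "K i \<ge> 0" for i using K[of i 0] by linarith
  have H0: "(\<Sum>l\<in>UNIV. \<Sum>j\<in>UNIV. A i j l * B j) + K i \<ge> 0" for i
    by (intro add_nonneg_nonneg sum_nonneg mult_nonneg_nonneg A_nonneg B_nonneg K0)
  show ?thesis
  proof
    show "(\<Sum>i\<in>UNIV. (\<Sum>l\<in>UNIV. \<Sum>j\<in>UNIV. A i j l * B j) + K i) \<ge> 0" by (intro sum_nonneg H0)
    fix u i t
    have "\<bar>\<Sum>l\<in>UNIV. \<Sum>j\<in>UNIV. a i j l t * g j (\<sigma> j * u j (t - \<tau> i j l t))\<bar> \<le>
      (\<Sum>l\<in>UNIV. \<Sum>j\<in>UNIV. \<bar>a i j l t * g j (\<sigma> j * u j (t - \<tau> i j l t))\<bar>)"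
      by (rule order_trans[OF sum_abs]) (intro sum_mono sum_abs)
    also have "\<dots> \<le> (\<Sum>l\<in>UNIV. \<Sum>j\<in>UNIV. A i j l * B j)"
      unfolding abs_mult by (intro sum_mono mult_mono a_le g_le A_nonneg) auto
    finally have "\<bar>F u i t\<bar> \<le> (\<Sum>l\<in>UNIV. \<Sum>j\<in>UNIV. A i j l * B j) + K i"
      unfolding forcing_def using K[of i t] by linarith
    also have "\<dots> \<le> (\<Sum>i\<in>UNIV. (\<Sum>l\<in>UNIV. \<Sum>j\<in>UNIV. A i j l * B j) + K i)"
      using H0 by (intro member_le_sum) auto
    finally show "\<bar>F u i t\<bar> \<le> (\<Sum>i\<in>UNIV. (\<Sum>l\<in>UNIV. \<Sum>j\<in>UNIV. A i j l * B j) + K i)" .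
  qed
qed

lemma forcing_continuous:
  assumes "\<And>j. continuous_on UNIV (u j)"
  shows "continuous_on UNIV (F u i)"
  unfolding forcing_def
  by (intro continuous_intros almost_periodic_continuous[OF ap_a] almost_periodic_continuous[OF ap_J]
      almost_periodic_continuous[OF ap_\<tau>] continuous_on_compose2[OF g_cont] continuous_on_compose2[OF assms]) auto

text \<open>\<open>gain\<close> is strict in each of finitely many rows, so even the worst ratio
  stays below 1.\<close>

lemma contraction_factor:
  obtains \<theta> where "0 \<le> \<theta>" "\<theta> < 1" "\<And>i. G i \<le> \<theta> * (c0 i * \<xi> i)"
proof -
  define \<theta> where "\<theta> = Max (range (\<lambda>i. G i / (c0 i * \<xi> i)))"
  have pos: "c0 i * \<xi> i > 0" for i using c0_pos \<xi>_pos by simp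
  have le: "G i / (c0 i * \<xi> i) \<le> \<theta>" for i unfolding \<theta>_def by (intro Max_ge) auto
  show ?thesis
  proof
    have "0 \<le> G i / (c0 i * \<xi> i)" for i using G_nonneg pos[of i] by (intro divide_nonneg_pos)
    then show "0 \<le> \<theta>" using le order_trans by blast
    show "\<theta> < 1" unfolding \<theta>_def using gain pos by (subst Max_less_iff) auto
    show "G i \<le> \<theta> * (c0 i * \<xi> i)" for i using le[of i] pos[of i] by (simp add: pos_divide_le_eq)
  qed
qed

section \<open>Bounded entire solutions as fixed points\<close>

lemma solves_diff:
  assumes "solves W u v" "solves W u' v'" "t \<in> W"
  shows "((\<lambda>t. v i t - v' i t) has_real_derivative
    (- c i t * (v i t - v' i t) + (F u i t - F u' i t))) (at t within W)"
proof -
  have "((\<lambda>t. v i t - v' i t) has_real_derivative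
    ((- c i t * v i t + F u i t) - (- c i t * v' i t + F u' i t))) (at t within W)"
    using assms unfolding solves_def by (intro DERIV_diff) auto
  then show ?thesis by (simp add: algebra_simps)
qed

lemma solves_signed:
  assumes "solves W u v" "t \<in> W"
  shows "((\<lambda>t. e i * v i t) has_real_derivative (- c i t * (e i * v i t) + e i * F u i t)) (at t within W)"
proof -
  have "((\<lambda>t. e i * v i t) has_real_derivative (e i * (- c i t * v i t + F u i t))) (at t within W)"
    using assms unfolding solves_def by (intro DERIV_cmult) auto
  then show ?thesis by (simp add: algebra_simps)
qed

text \<open>The difference of the outputs obeys a linear equation whose forcing is at most
  \<open>D * G i\<close>, hence at most \<open>c i t * (\<theta> * D * \<xi> i)\<close>. The value
  of \<open>M\<close> does not appear in the conclusion; a bound of some kind excludes homogeneous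
  solutions that grow backwards in time.\<close>

lemma solves_contraction_line:
  assumes "solves UNIV u v" "solves UNIV u' v'" "\<And>t. in_sector u t" "\<And>t. in_sector u' t"
    and G: "\<And>i. G i \<le> \<theta> * (c0 i * \<xi> i)" and "D \<ge> 0" "\<theta> \<ge> 0"
    and D: "\<And>i t. \<bar>u i t - u' i t\<bar> \<le> D * \<xi> i"
    and bd: "\<And>t. \<bar>v i t - v' i t\<bar> \<le> M"
  shows "\<bar>v i t - v' i t\<bar> \<le> \<theta> * D * \<xi> i"
proof (rule linear_abs_bound_line[OF c_cont c0_pos c0_le _ _ bd])
  show "((\<lambda>t. v i t - v' i t) has_real_derivative
    (- c i t * (v i t - v' i t) + (F u i t - F u' i t))) (at t)" for t
    using solves_diff[OF assms(1,2)] by simp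
  show "\<bar>F u i t - F u' i t\<bar> \<le> c i t * (\<theta> * D * \<xi> i)" for t
  proof -
    have "\<bar>F u i t - F u' i t\<bar> \<le> D * G i" by (intro forcing_diff assms)
    also have "\<dots> \<le> D * (\<theta> * (c0 i * \<xi> i))" by (intro mult_left_mono G \<open>D \<ge> 0\<close>)
    also have "\<dots> = c0 i * (\<theta> * D * \<xi> i)" by simp
    also have "\<dots> \<le> c i t * (\<theta> * D * \<xi> i)"
      using \<open>D \<ge> 0\<close> \<open>\<theta> \<ge> 0\<close> less_imp_le[OF \<xi>_pos] by (intro mult_right_mono c0_le mult_nonneg_nonneg)
    finally show ?thesis .
  qed
qed

lemma entire_solution:
  obtains u M where "solves UNIV u u" "\<And>t. in_sector u t" "\<And>i t. \<bar>u i t\<bar> \<le> M"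
proof -
  obtain H where H: "H \<ge> 0" "\<And>u i t. \<bar>F u i t\<bar> \<le> H" using forcing_bounded by blast
  obtain \<theta> where \<theta>: "0 \<le> \<theta>" "\<theta> < 1" "\<And>i. G i \<le> \<theta> * (c0 i * \<xi> i)" using contraction_factor by blast
  \<comment> \<open>Covers both the bound \<open>H / c0 i\<close> on the outputs of
    \<open>linear_solution_bounded\<close> and the size \<open>\<bar>b i\<bar>\<close> of the
    starting point.\<close>
  define M where "M = (\<Sum>i\<in>UNIV. H / c0 i + \<bar>b i\<bar>)"
  have "H / c0 i + \<bar>b i\<bar> \<le> M" for i
    unfolding M_def using H(1) c0_pos by (intro member_le_sum) (auto intro!: add_nonneg_nonneg simp: less_imp_le)
  moreover have "H / c0 i \<ge> 0" for i using H(1) c0_pos[of i] by simp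
  ultimately have M: "H / c0 i \<le> M" "\<bar>b i\<bar> \<le> M" for i
    using abs_ge_zero add_increasing add_increasing2 order_trans order_refl by metis+
  define Y where "Y i (t::real) = {x. e i * x \<le> b i} \<inter> {- M..M}" for i t
  define X where "X = {u. (\<forall>i. continuous_on UNIV (u i)) \<and> (\<forall>i t. u i t \<in> Y i t)}"
  have X: "continuous_on UNIV (u i)" "in_sector u t" "\<bar>u i t\<bar> \<le> M" if "u \<in> X" for u i t
    using that unfolding X_def Y_def in_sector_def by (auto simp: abs_le_iff minus_le_iff)
  have "\<exists>u\<in>X. solves UNIV u u"
  proof (rule weighted_picard[where R = "solves UNIV", OF X_def])
    show "closed (Y i t)" for i t
      unfolding Y_def by (intro closed_Int closed_Collect_le continuous_intros closed_atLeastAtMost)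
    show "Y i t \<subseteq> {- M..M}" for i t unfolding Y_def by blast
    \<comment> \<open>The iteration starts at the corner of the sector: since
      \<open>e i * e i = 1\<close>, the constant \<open>e i * b i\<close> satisfies the sector
      condition with equality.\<close>
    have "e i * (e i * b i) \<le> b i" "- M \<le> e i * b i" "e i * b i \<le> M" for i
      using sign[of i] M(2)[of i] by auto
    then show "(\<lambda>i t. e i * b i) \<in> X" unfolding X_def Y_def by (simp del: mult_minus_left)
    show "0 \<le> \<theta>" "\<theta> < 1" "\<And>i. \<xi> i > 0" using \<theta> \<xi>_pos by auto
    show "\<bar>v i t - v' i t\<bar> \<le> \<theta> * D * \<xi> i"
      if "u \<in> X" "v \<in> X" "u' \<in> X" "v' \<in> X" "solves UNIV u v" "solves UNIV u' v'" "D \<ge> 0"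
        "\<And>i t. \<bar>u i t - u' i t\<bar> \<le> D * \<xi> i" for u v u' v' D i t
    proof -
      have bd: "\<bar>v i t - v' i t\<bar> \<le> M + M" for t
        using X(3)[OF that(2), of i t] X(3)[OF that(4), of i t] by linarith
      show ?thesis
        by (rule solves_contraction_line[OF that(5,6) X(2)[OF that(1)] X(2)[OF that(3)] \<theta>(3) that(7) \<theta>(1) that(8) bd])
    qed
    fix u assume u: "u \<in> X"
    have "\<exists>y. (\<forall>t. (y has_real_derivative - c i t * y t + F u i t) (at t)) \<and> (\<forall>t. \<bar>y t\<bar> \<le> H / c0 i)" for i
      by (rule linear_solution_bounded[OF c_cont[of i] forcing_continuous[of u i] c0_pos c0_le H(2)[of u i]])
         (use X(1)[OF u] in blast)+
    then obtain v where v: "\<And>i t. (v i has_real_derivative - c i t * v i t + F u i t) (at t)"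
      "\<And>i t. \<bar>v i t\<bar> \<le> H / c0 i" by metis
    have sv: "solves UNIV u v" unfolding solves_def using v(1) by simp
    have "e i * v i t \<le> b i" for i t
    proof (rule linear_upper_bound_line[where y = "\<lambda>t. e i * v i t" and h = "\<lambda>t. e i * F u i t",
          OF c_cont[of i] c0_pos c0_le])
      show "((\<lambda>t. e i * v i t) has_real_derivative (- c i t * (e i * v i t) + e i * F u i t)) (at t)" for t
        using solves_signed[OF sv] by simp
      show "e i * F u i t \<le> c i t * b i" for t
        using X(2)[OF u] by (intro sector) (auto simp: in_sector_def)
      show "e i * v i t \<le> H / c0 i" for t
        using v(2)[of i t] sign[of i] by (auto simp: abs_le_iff)
    qed
    moreover have "continuous_on UNIV (v i)" for i
      using v(1) by (meson DERIV_isCont continuous_at_imp_continuous_on)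
    moreover have "\<bar>v i t\<bar> \<le> M" for i t using v(2)[of i t] M(1)[of i] by linarith
    ultimately have "v \<in> X" unfolding X_def Y_def by (auto simp: abs_le_iff minus_le_iff)
    then show "\<exists>v\<in>X. solves UNIV u v" using sv by blast
  qed
  then show ?thesis using that X by blast
qed

text \<open>The weighted norm is an ordinary supremum of \<open>\<bar>w i t\<bar> / \<xi> i\<close>
  over pairs of index and time, made finite by \<open>M\<close>; \<open>contraction_bound\<close>
  applies to it.\<close>

lemma weighted_sup_bound:
  fixes w :: "'n \<Rightarrow> real \<Rightarrow> real"
  assumes M: "\<And>i t. \<bar>w i t\<bar> \<le> M" and "\<theta> < 1"
    and step: "\<And>D i t. D \<ge> 0 \<Longrightarrow> (\<And>i t. \<bar>w i t\<bar> \<le> D * \<xi> i) \<Longrightarrow> \<bar>w i t\<bar> \<le> (\<theta> * D + \<epsilon>) * \<xi> i"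
  shows "\<bar>w i t\<bar> \<le> \<epsilon> / (1 - \<theta>) * \<xi> i"
proof -
  define f where "f = (\<lambda>(i, t). \<bar>w i t\<bar> / \<xi> i)"
  have f_le: "f (i, t) \<le> D \<longleftrightarrow> \<bar>w i t\<bar> \<le> D * \<xi> i" for i t D
    unfolding f_def using \<xi>_pos[of i] by (simp add: pos_divide_le_eq)
  have "f (i, t) \<le> \<epsilon> / (1 - \<theta>)"
  proof (rule contraction_bound[where f = f, OF _ \<open>\<theta> < 1\<close>])
    show "f x \<le> (\<Sum>i\<in>UNIV. M / \<xi> i)" for x
    proof (cases x)
      case (Pair i t)
      have "M \<ge> 0" using M[of i t] by linarith
      have "f x \<le> M / \<xi> i" unfolding Pair f_def using M \<xi>_pos[of i] by (simp add: divide_right_mono)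
      also have "\<dots> \<le> (\<Sum>i\<in>UNIV. M / \<xi> i)"
        using \<open>M \<ge> 0\<close> less_imp_le[OF \<xi>_pos] by (intro member_le_sum divide_nonneg_nonneg) auto
      finally show ?thesis .
    qed
    fix D and x :: "'n \<times> real" assume D: "\<And>x. f x \<le> D"
    obtain i t where x: "x = (i, t)" by (cases x)
    have "0 \<le> f x" unfolding x f_def using less_imp_le[OF \<xi>_pos] by simp
    then have "D \<ge> 0" using D[of x] by linarith
    then have "\<bar>w i t\<bar> \<le> (\<theta> * D + \<epsilon>) * \<xi> i"
      by (rule step) (use D f_le in blast)
    then show "f x \<le> \<theta> * D + \<epsilon>" unfolding x f_le .
  qed
  then show ?thesis unfolding f_le .
qed

lemma entire_solution_unique:
  assumes "solves UNIV u u" "solves UNIV v v" "\<And>t. in_sector u t" "\<And>t. in_sector v t"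
    and M: "\<And>i t. \<bar>u i t\<bar> \<le> M" "\<And>i t. \<bar>v i t\<bar> \<le> M"
  shows "u = v"
proof -
  obtain \<theta> where \<theta>: "0 \<le> \<theta>" "\<theta> < 1" "\<And>i. G i \<le> \<theta> * (c0 i * \<xi> i)" using contraction_factor by blast
  have bd: "\<bar>u i t - v i t\<bar> \<le> M + M" for i t using M(1)[of i t] M(2)[of i t] by linarith
  have "\<bar>u i t - v i t\<bar> \<le> 0 / (1 - \<theta>) * \<xi> i" for i t
  proof (rule weighted_sup_bound[where w = "\<lambda>i t. u i t - v i t", OF bd \<theta>(2)])
    show "\<bar>u i t - v i t\<bar> \<le> (\<theta> * D + 0) * \<xi> i"
      if "D \<ge> 0" "\<And>i t. \<bar>u i t - v i t\<bar> \<le> D * \<xi> i" for D i t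
      using solves_contraction_line[OF assms(1-4) \<theta>(3) that(1) \<theta>(1) that(2) bd] by simp
  qed
  then have "\<bar>u i t - v i t\<bar> \<le> 0" for i t by simp
  then show ?thesis by (intro ext) (metis abs_le_zero_iff eq_iff_diff_eq_0)
qed

section \<open>Initial value problems\<close>

text \<open>One fixed point on the whole half line, without stepping: the decay makes the solution
  operator a contraction however small the delays become. The history is built into the function
  space by the singletons \<open>Y i t\<close> for \<open>t \<le> 0\<close>.\<close>

lemma ivp_solution:
  assumes \<phi>: "\<And>i. continuous_on {-k..0} (\<phi> i)" "\<And>t. t \<in> {-k..0} \<Longrightarrow> in_sector \<phi> t"
  obtains u where "\<And>i. continuous_on UNIV (u i)" "\<And>i t. t \<in> {-k..0} \<Longrightarrow> u i t = \<phi> i t" "solves {0..} u u"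
proof -
  obtain H where H: "H \<ge> 0" "\<And>u i t. \<bar>F u i t\<bar> \<le> H" using forcing_bounded by blast
  obtain \<theta> where \<theta>: "0 \<le> \<theta>" "\<theta> < 1" "\<And>i. G i \<le> \<theta> * (c0 i * \<xi> i)" using contraction_factor by blast
  \<comment> \<open>Clamping the time extends the history continuously to the whole line without
    leaving the sector.\<close>
  define \<psi> where "\<psi> i t = \<phi> i (max (- k) (min t 0))" for i t
  have clamp: "max (- k) (min t 0) \<in> {-k..0}" for t using k_pos by auto
  have \<psi>_cont: "continuous_on UNIV (\<psi> i)" for i
    unfolding \<psi>_def by (rule continuous_on_compose2[OF \<phi>(1)]) (use clamp in \<open>auto intro!: continuous_intros\<close>)
  have \<psi>_sector: "in_sector \<psi> t" for t
    using \<phi>(2)[OF clamp[of t]] unfolding in_sector_def \<psi>_def .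
  have "\<exists>K. \<forall>t\<in>{-k..0}. \<bar>\<phi> i t\<bar> \<le> K" for i
    using compact_imp_bounded[OF compact_continuous_image[OF \<phi>(1) compact_Icc]]
    unfolding bounded_iff by (metis image_eqI real_norm_def)
  then obtain K where "\<And>i t. t \<in> {-k..0} \<Longrightarrow> \<bar>\<phi> i t\<bar> \<le> K i" by metis
  then have K: "\<bar>\<psi> i t\<bar> \<le> K i" for i t unfolding \<psi>_def using clamp by blast
  have K0: "K i \<ge> 0" for i using K[of i 0] by linarith
  have Hc: "H / c0 i \<ge> 0" for i using H(1) c0_pos[of i] by simp
  define M where "M = (\<Sum>i\<in>UNIV. H / c0 i + K i)"
  have "H / c0 i + K i \<le> M" for i
    unfolding M_def using Hc K0 by (intro member_le_sum add_nonneg_nonneg) auto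
  then have M: "H / c0 i \<le> M" "K i \<le> M" for i
    using Hc[of i] K0[of i] by (smt (verit) add_increasing)+
  then have HM: "H \<le> c i t * M" for i t
  proof -
    have "H \<le> c0 i * M" using M(1)[of i] c0_pos[of i] by (simp add: pos_divide_le_eq mult.commute)
    also have "\<dots> \<le> c i t * M" using order_trans[OF Hc M(1)] by (intro mult_right_mono c0_le)
    finally show ?thesis .
  qed
  define Y where "Y i t = (if t \<le> 0 then {\<psi> i t} else {x. e i * x \<le> b i} \<inter> {- M..M})" for i t
  define X where "X = {u. (\<forall>i. continuous_on UNIV (u i)) \<and> (\<forall>i t. u i t \<in> Y i t)}"
  have \<psi>M: "\<psi> i t \<in> {- M..M}" for i t using K[of i t] M(2)[of i] by auto
  have Xeq: "u i t = \<psi> i t" if "u \<in> X" "t \<le> 0" for u i t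
  proof -
    have "u i t \<in> Y i t" using that(1) unfolding X_def by blast
    then show ?thesis using that(2) unfolding Y_def by simp
  qed
  have Xsec: "in_sector u t" if "u \<in> X" for u t
    unfolding in_sector_def
  proof
    fix i
    have "u i t \<in> Y i t" using that unfolding X_def by blast
    then show "e i * u i t \<le> b i"
      using \<psi>_sector[of t] unfolding in_sector_def Y_def by (auto split: if_splits)
  qed
  have Xcont: "continuous_on UNIV (u i)" if "u \<in> X" for u i using that unfolding X_def by blast
  have "\<exists>u\<in>X. solves {0..} u u"
  proof (rule weighted_picard[where R = "solves {0..}", OF X_def])
    show "closed (Y i t)" for i t
      unfolding Y_def by (auto intro!: closed_Int closed_Collect_le continuous_intros)
    show "Y i t \<subseteq> {- M..M}" for i t unfolding Y_def using \<psi>M[of i t] by auto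
    show "\<psi> \<in> X"
      unfolding X_def Y_def using \<psi>_cont \<psi>M \<psi>_sector by (auto simp: in_sector_def)
    show "0 \<le> \<theta>" "\<theta> < 1" "\<And>i. \<xi> i > 0" using \<theta> \<xi>_pos by auto
    show "\<bar>v i t - v' i t\<bar> \<le> \<theta> * D * \<xi> i"
      if "u \<in> X" "v \<in> X" "u' \<in> X" "v' \<in> X" "solves {0..} u v" "solves {0..} u' v'" "D \<ge> 0"
        "\<And>i t. \<bar>u i t - u' i t\<bar> \<le> D * \<xi> i" for u v u' v' D i t
    proof -
      have nn: "0 \<le> \<theta> * D * \<xi> i" using \<theta>(1) that(7) less_imp_le[OF \<xi>_pos] by simp
      show ?thesis
      proof (cases "t \<le> 0")
        case True
        then show ?thesis using Xeq[OF that(2)] Xeq[OF that(4)] nn by simp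
      next
        case False
        show ?thesis
        proof (rule linear_abs_bound_half_line[where c = "c i" and ?t0.0 = 0 and y = "\<lambda>t. v i t - v' i t"
              and h = "\<lambda>t. F u i t - F u' i t"])
          show "continuous_on UNIV (c i)" by (rule c_cont)
          show "0 \<le> t" using False by simp
          show "continuous_on {0..t} (\<lambda>t. v i t - v' i t)"
            using Xcont[OF that(2)] Xcont[OF that(4)]
            by (intro continuous_on_diff) (meson continuous_on_subset subset_UNIV)+
          show "((\<lambda>t. v i t - v' i t) has_real_derivative
            - c i x * (v i x - v' i x) + (F u i x - F u' i x)) (at x)" if "0 < x" for x
            using solves_diff[OF \<open>solves {0..} u v\<close> \<open>solves {0..} u' v'\<close>, of x i]
              at_within_interior[of x "{0..}"] that by simp
          show "\<bar>F u i x - F u' i x\<bar> \<le> c i x * (\<theta> * D * \<xi> i)" for x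
          proof -
            have "\<bar>F u i x - F u' i x\<bar> \<le> D * G i" by (intro forcing_diff Xsec that)
            also have "\<dots> \<le> D * (\<theta> * (c0 i * \<xi> i))" by (intro mult_left_mono \<theta> that)
            also have "\<dots> = c0 i * (\<theta> * D * \<xi> i)" by simp
            also have "\<dots> \<le> c i x * (\<theta> * D * \<xi> i)" by (intro mult_right_mono c0_le nn)
            finally show ?thesis .
          qed
          show "\<bar>v i 0 - v' i 0\<bar> \<le> \<theta> * D * \<xi> i"
            using Xeq[OF that(2)] Xeq[OF that(4)] nn by simp
        qed
      qed
    qed
    fix u assume u: "u \<in> X"
    have "\<exists>y. (\<forall>t. (y has_real_derivative - c i t * y t + F u i t) (at t)) \<and> y 0 = \<psi> i 0" for i
      by (rule linear_solution_ivp[OF c_cont[of i] forcing_continuous[of u i], of "\<psi> i 0"])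
         (use Xcont[OF u] in blast)+
    then obtain y where y: "\<And>i t. (y i has_real_derivative - c i t * y i t + F u i t) (at t)"
      "\<And>i. y i 0 = \<psi> i 0" by metis
    \<comment> \<open>History up to 0 and \<open>y\<close> afterwards, glued by one formula instead
      of a case distinction so that continuity follows by composition; the pieces fit because
      \<open>y i 0 = \<psi> i 0\<close>.\<close>
    define v where "v i t = \<psi> i (min t 0) + (y i (max t 0) - y i 0)" for i t
    have v_neg: "v i t = \<psi> i t" if "t \<le> 0" for i t using that by (simp add: v_def)
    have v_pos: "v i t = y i t" if "t \<ge> 0" for i t using that y(2) by (simp add: v_def)
    have y_cont: "continuous_on S (y i)" for i S
      using y(1) by (meson DERIV_isCont continuous_at_imp_continuous_on)
    have "solves {0..} u v"
      unfolding solves_def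
    proof (intro allI ballI)
      fix i t assume t: "t \<in> {0::real..}"
      have "(y i has_real_derivative - c i t * v i t + F u i t) (at t within {0..})"
        using has_field_derivative_at_within[OF y(1)[of i t]] v_pos[of t i] t by simp
      then show "(v i has_real_derivative - c i t * v i t + F u i t) (at t within {0..})"
        by (rule has_field_derivative_transform_within[of _ _ _ _ 1]) (use t v_pos in auto)
    qed
    moreover have "v \<in> X"
      unfolding X_def
    proof (intro CollectI conjI allI)
      fix i
      show "continuous_on UNIV (v i)"
        unfolding v_def
        by (intro continuous_intros continuous_on_compose2[OF \<psi>_cont] continuous_on_compose2[OF y_cont[of UNIV]]) auto
      fix t show "v i t \<in> Y i t"
      proof (cases "t \<le> 0")
        case True
        then show ?thesis by (simp add: Y_def v_neg)
      next
        case False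
        have "\<bar>y i t\<bar> \<le> M"
        proof (rule linear_abs_bound_half_line[OF c_cont[of i] _ y_cont y(1)])
          show "0 \<le> t" using False by simp
          show "\<bar>F u i x\<bar> \<le> c i x * M" for x using H(2)[of u i x] HM[of i x] by linarith
          show "\<bar>y i 0\<bar> \<le> M" using y(2)[of i] \<psi>M[of i 0] by auto
        qed
        moreover have "e i * y i t \<le> b i"
        proof (rule linear_upper_bound_half_line[where c = "c i" and ?t0.0 = 0 and y = "\<lambda>t. e i * y i t"
              and h = "\<lambda>t. e i * F u i t"])
          show "((\<lambda>t. e i * y i t) has_real_derivative - c i x * (e i * y i x) + e i * F u i x) (at x)" for x
            using DERIV_cmult[OF y(1)[of i x], of "e i"] by (simp add: algebra_simps)
          show "e i * F u i x \<le> c i x * b i" for x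
            using Xsec[OF u] by (intro sector) (auto simp: in_sector_def)
          show "e i * y i 0 \<le> b i" using y(2)[of i] \<psi>_sector[of 0] by (simp add: in_sector_def)
        qed (use False c_cont y_cont in \<open>auto intro!: continuous_intros\<close>)
        ultimately show ?thesis using False v_pos[of t i] by (auto simp: Y_def)
      qed
    qed
    ultimately show "\<exists>v\<in>X. solves {0..} u v" by blast
  qed
  then obtain u where u: "u \<in> X" "solves {0..} u u" by blast
  show ?thesis
    by (rule that[OF Xcont[OF u(1)] _ u(2)]) (use Xeq[OF u(1)] in \<open>auto simp: \<psi>_def\<close>)
qed

text \<open>The infimum of a delay over the whole line may be zero, but not over a compact interval; this
  makes the method of steps available.\<close>

lemma delay_lower_bound:
  obtains \<delta> where "\<delta> > 0" "\<And>i j l t. t \<in> {0..T} \<Longrightarrow> \<delta> \<le> \<tau> i j l t"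
proof (cases "T \<ge> 0")
  case True
  have "\<exists>x. \<forall>t\<in>{0..T}. \<tau> i j l x \<le> \<tau> i j l t" for i j l
    using continuous_attains_inf[OF compact_Icc _ almost_periodic_continuous[OF ap_\<tau>], of 0 T i j l] True
    by auto
  then obtain x where x: "\<And>i j l t. t \<in> {0..T} \<Longrightarrow> \<tau> i j l (x i j l) \<le> \<tau> i j l t" by metis
  define \<delta> where "\<delta> = Min (range (\<lambda>(i, j, l). \<tau> i j l (x i j l)))"
  show ?thesis
  proof
    show "\<delta> > 0" unfolding \<delta>_def using \<tau>_pos by (subst Min_gr_iff) auto
    show "\<delta> \<le> \<tau> i j l t" if "t \<in> {0..T}" for i j l t
    proof -
      have "\<delta> \<le> \<tau> i j l (x i j l)"
        unfolding \<delta>_def by (rule Min_le) (auto intro: image_eqI[where x = "(i, j, l)"])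
      then show ?thesis using x[OF that, of i j l] by linarith
    qed
  qed
qed (use that[of 1] in auto)

text \<open>The target \<open>t\<close> is fixed before the step length, so a lower bound of the
  delays on \<open>{0..t}\<close> suffices. In \<open>step\<close>, \<open>P\<close> is available at
  the delayed times of all \<open>s\<close> in \<open>{0..t}\<close>, which is what a comparison
  argument on that interval consumes.\<close>

lemma history_induct:
  assumes init: "\<And>t. t \<in> {-k..0} \<Longrightarrow> P t"
    and step: "\<And>t. t > 0 \<Longrightarrow> (\<And>s i j l. 0 \<le> s \<Longrightarrow> s \<le> t \<Longrightarrow> P (s - \<tau> i j l s)) \<Longrightarrow> P t"
    and "t \<ge> - k"
  shows "P t"
proof -
  obtain \<delta> where \<delta>: "\<delta> > 0" "\<And>i j l s. s \<in> {0..t} \<Longrightarrow> \<delta> \<le> \<tau> i j l s" using delay_lower_bound by blast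
  show ?thesis
  proof (rule delay_induct[where \<delta> = \<delta> and Q = "\<lambda>r. - k \<le> r \<and> r \<le> t" and lo = "- k", OF \<delta>(1)])
    fix r assume r: "- k \<le> r \<and> r \<le> t" and IH: "\<And>q. - k \<le> q \<and> q \<le> t \<Longrightarrow> q \<le> r - \<delta> \<Longrightarrow> P q"
    show "P r"
    proof (cases "r \<le> 0")
      case False
      show ?thesis
      proof (rule step)
        show "P (s - \<tau> i j l s)" if s: "0 \<le> s" "s \<le> r" for s i j l
          using \<delta>(2)[of s i j l] \<tau>_le[of i j l s] \<tau>_pos[of i j l s] s r by (intro IH) auto
      qed (use False in simp)
    qed (use init r in simp)
  qed (use assms(3) in auto)
qed

section \<open>Invariance of the sector and exponential decay\<close>

text \<open>The stability estimate is about every solution of the initial value problem, not only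
  the constructed one. Membership at the delayed times bounds the forcing through
  \<open>sector\<close>, and linear comparison carries the bound to \<open>t\<close>.\<close>

lemma sector_invariant:
  assumes u: "\<And>i. continuous_on {-k..} (u i)" "solves {0..} u u" "\<And>t. t \<in> {-k..0} \<Longrightarrow> in_sector u t"
    and "t \<ge> - k"
  shows "in_sector u t"
proof (rule history_induct[OF u(3) _ \<open>t \<ge> - k\<close>])
  fix t :: real assume t: "t > 0" and IH: "\<And>s i j l. 0 \<le> s \<Longrightarrow> s \<le> t \<Longrightarrow> in_sector u (s - \<tau> i j l s)"
  show "in_sector u t"
    unfolding in_sector_def
  proof
    fix i
    show "e i * u i t \<le> b i"
    proof (rule linear_upper_bound_half_line[where c = "c i" and ?t0.0 = 0 and y = "\<lambda>t. e i * u i t"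
          and h = "\<lambda>t. e i * F u i t"])
      show "((\<lambda>t. e i * u i t) has_real_derivative - c i x * (e i * u i x) + e i * F u i x) (at x)"
        if "0 < x" for x
        using solves_signed[OF u(2), of x i] at_within_interior[of x "{0..}"] that by simp
      show "e i * F u i x \<le> c i x * b i" if "0 < x" "x < t" for x
        using IH[of x] that by (intro sector) (auto simp: in_sector_def)
      show "e i * u i 0 \<le> b i" using u(3)[of 0] k_pos by (simp add: in_sector_def)
      show "continuous_on {0..t} (\<lambda>t. e i * u i t)"
        by (intro continuous_intros continuous_on_subset[OF u(1)]) (use k_pos in auto)
    qed (use t c_cont in auto)
  qed
qed simp

text \<open>At \<open>\<mu> = 0\<close> the inequality is \<open>gain\<close>, which is strict;
  continuity in \<open>\<mu>\<close>, for finitely many rows, leaves room for a positive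
  rate.\<close>

lemma decay_rate:
  obtains \<mu> where "\<mu> > 0" "\<And>i. exp (\<mu> * k) * G i \<le> (c0 i - \<mu>) * \<xi> i"
proof -
  have "\<forall>\<^sub>F \<mu> in at_right 0. \<forall>i. exp (\<mu> * k) * G i < (c0 i - \<mu>) * \<xi> i"
  proof (rule eventually_all_finite)
    fix i
    have "((\<lambda>\<mu>. (c0 i - \<mu>) * \<xi> i - exp (\<mu> * k) * G i) \<longlongrightarrow> (c0 i - 0) * \<xi> i - exp (0 * k) * G i) (at_right 0)"
      by (intro tendsto_intros)
    then have "\<forall>\<^sub>F \<mu> in at_right 0. 0 < (c0 i - \<mu>) * \<xi> i - exp (\<mu> * k) * G i"
      by (rule order_tendstoD) (use gain[of i] in simp)
    then show "\<forall>\<^sub>F \<mu> in at_right 0. exp (\<mu> * k) * G i < (c0 i - \<mu>) * \<xi> i"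
      by eventually_elim simp
  qed
  then have "\<forall>\<^sub>F \<mu> in at_right 0. \<mu> > 0 \<and> (\<forall>i. exp (\<mu> * k) * G i < (c0 i - \<mu>) * \<xi> i)"
    using eventually_at_right_less[of "0::real"] eventually_conj by blast
  then obtain \<mu> where "\<mu> > 0" "\<And>i. exp (\<mu> * k) * G i < (c0 i - \<mu>) * \<xi> i"
    using eventually_happens' trivial_limit_at_right_real by blast
  then show ?thesis using that less_imp_le by blast
qed

text \<open>The rescaled difference obeys a linear equation with \<open>c - \<mu>\<close> in place
  of \<open>c\<close>. Its forcing involves differences at most \<open>k\<close> earlier, whose
  bounds are larger by a factor of at most \<open>exp (\<mu> * k)\<close>; the choice of
  \<open>\<mu>\<close> absorbs this, so the constant \<open>D\<close> is carried along
  unchanged.\<close>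

lemma exponential_estimate:
  assumes \<mu>: "\<mu> > 0" "\<And>i. exp (\<mu> * k) * G i \<le> (c0 i - \<mu>) * \<xi> i"
    and u: "\<And>i. continuous_on {-k..} (u i)" "solves {0..} u u" "\<And>t. t \<ge> - k \<Longrightarrow> in_sector u t"
    and v: "\<And>i. continuous_on {-k..} (v i)" "solves {0..} v v" "\<And>t. t \<ge> - k \<Longrightarrow> in_sector v t"
    and D: "D \<ge> 0" "\<And>i t. t \<in> {-k..0} \<Longrightarrow> \<bar>u i t - v i t\<bar> \<le> D * \<xi> i"
    and "t \<ge> - k"
  shows "\<forall>i. \<bar>u i t - v i t\<bar> \<le> D * exp (- \<mu> * t) * \<xi> i"
proof (rule history_induct[OF _ _ \<open>t \<ge> - k\<close>])
  fix t assume t: "t \<in> {-k..0}"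
  show "\<forall>i. \<bar>u i t - v i t\<bar> \<le> D * exp (- \<mu> * t) * \<xi> i"
  proof
    fix i
    have "D * 1 \<le> D * exp (- \<mu> * t)"
      using D(1) t \<mu>(1) by (intro mult_left_mono) (auto simp: mult_nonneg_nonpos)
    then have "D * \<xi> i \<le> D * exp (- \<mu> * t) * \<xi> i" using \<xi>_pos[of i] by (intro mult_right_mono) auto
    then show "\<bar>u i t - v i t\<bar> \<le> D * exp (- \<mu> * t) * \<xi> i" using D(2)[OF t, of i] by linarith
  qed
next
  fix t :: real assume t: "t > 0"
    and IH: "\<And>s i j l. 0 \<le> s \<Longrightarrow> s \<le> t \<Longrightarrow> \<forall>n. \<bar>u n (s - \<tau> i j l s) - v n (s - \<tau> i j l s)\<bar> \<le>
      D * exp (- \<mu> * (s - \<tau> i j l s)) * \<xi> n"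
  show "\<forall>i. \<bar>u i t - v i t\<bar> \<le> D * exp (- \<mu> * t) * \<xi> i"
  proof
    fix i
    let ?z = "\<lambda>t. exp (\<mu> * t) * (u i t - v i t)"
    have "\<bar>?z t\<bar> \<le> D * \<xi> i"
    proof (rule linear_abs_bound_half_line[where c = "\<lambda>t. c i t - \<mu>" and ?t0.0 = 0 and y = ?z
          and h = "\<lambda>t. exp (\<mu> * t) * (F u i t - F v i t)"])
      show "continuous_on UNIV (\<lambda>t. c i t - \<mu>)" by (intro continuous_intros c_cont)
      show "0 \<le> t" using t by simp
      show "continuous_on {0..t} ?z"
        by (intro continuous_intros continuous_on_subset[OF u(1)] continuous_on_subset[OF v(1)]) (use k_pos in auto)
      show "\<bar>?z 0\<bar> \<le> D * \<xi> i" using D(2)[of 0 i] k_pos by simp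
      show "(?z has_real_derivative - (c i x - \<mu>) * ?z x + exp (\<mu> * x) * (F u i x - F v i x)) (at x)"
        if "0 < x" for x
      proof -
        have d: "((\<lambda>t. u i t - v i t) has_real_derivative
          (- c i x * (u i x - v i x) + (F u i x - F v i x))) (at x)"
          using solves_diff[OF u(2) v(2), of x i] at_within_interior[of x "{0..}"] that by simp
        show ?thesis by (rule derivative_eq_intros d refl)+ (simp add: algebra_simps)
      qed
      show "\<bar>exp (\<mu> * x) * (F u i x - F v i x)\<bar> \<le> (c i x - \<mu>) * (D * \<xi> i)" if x: "0 < x" "x < t" for x
      proof -
        have arg: "x - \<tau> i j l x \<ge> - k" for j l using \<tau>_le[of i j l x] x by simp
        have "\<bar>F u i x - F v i x\<bar> \<le> D * exp (- \<mu> * (x - k)) * G i"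
        proof (intro forcing_diff u(3) v(3) arg)
          fix j l
          have "D * exp (- \<mu> * (x - \<tau> i j l x)) * \<xi> j \<le> D * exp (- \<mu> * (x - k)) * \<xi> j"
            using D(1) less_imp_le[OF \<xi>_pos] \<mu>(1) \<tau>_le[of i j l x]
            by (intro mult_right_mono mult_left_mono) auto
          then show "\<bar>u j (x - \<tau> i j l x) - v j (x - \<tau> i j l x)\<bar> \<le> D * exp (- \<mu> * (x - k)) * \<xi> j"
            using IH[of x i j l] x by (meson less_imp_le order_trans)
        qed
        then have "\<bar>exp (\<mu> * x) * (F u i x - F v i x)\<bar> \<le> exp (\<mu> * x) * (D * exp (- \<mu> * (x - k)) * G i)"
          unfolding abs_mult abs_exp_cancel by (intro mult_left_mono) auto
        also have "\<dots> = D * (exp (\<mu> * x + - \<mu> * (x - k)) * G i)" unfolding exp_add by (simp only: mult_ac)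
        also have "\<dots> = D * (exp (\<mu> * k) * G i)" by (simp add: algebra_simps)
        also have "\<dots> \<le> D * ((c0 i - \<mu>) * \<xi> i)" by (intro mult_left_mono \<mu> D)
        also have "\<dots> = (c0 i - \<mu>) * (D * \<xi> i)" by simp
        also have "\<dots> \<le> (c i x - \<mu>) * (D * \<xi> i)"
          using D(1) less_imp_le[OF \<xi>_pos] c0_le[of i x] by (intro mult_right_mono) auto
        finally show ?thesis .
      qed
    qed
    then have "exp (- \<mu> * t) * \<bar>?z t\<bar> \<le> exp (- \<mu> * t) * (D * \<xi> i)" by (intro mult_left_mono) auto
    moreover have "exp (- \<mu> * t) * \<bar>?z t\<bar> = exp (- \<mu> * t + \<mu> * t) * \<bar>u i t - v i t\<bar>"
      unfolding exp_add by (simp add: abs_mult)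
    ultimately have "exp (- \<mu> * t + \<mu> * t) * \<bar>u i t - v i t\<bar> \<le> exp (- \<mu> * t) * (D * \<xi> i)"
      by (simp only:)
    then show "\<bar>u i t - v i t\<bar> \<le> D * exp (- \<mu> * t) * \<xi> i" by (simp add: mult_ac)
  qed
qed

section \<open>Almost periodicity of the entire solution\<close>

lemma solution_lipschitz:
  assumes u: "solves UNIV u u" and M: "\<And>i t. \<bar>u i t\<bar> \<le> M"
  obtains \<Lambda> where "\<Lambda> \<ge> 0" "\<And>i x y. \<bar>u i x - u i y\<bar> \<le> \<Lambda> * \<bar>x - y\<bar>"
proof -
  obtain H where H: "H \<ge> 0" "\<And>u i t. \<bar>F u i t\<bar> \<le> H" using forcing_bounded by blast
  have "\<exists>K. \<forall>t. \<bar>c i t\<bar> \<le> K" for i using almost_periodic_bounded[OF ap_c[of i]] by metis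
  then obtain K where K: "\<And>i t. \<bar>c i t\<bar> \<le> K i" by metis
  have K0: "K i \<ge> 0" for i using K[of i 0] by linarith
  have "M \<ge> 0" using M[of undefined 0] by linarith
  define \<Lambda> where "\<Lambda> = (\<Sum>i\<in>UNIV. K i * M + H)"
  have "\<Lambda> \<ge> 0" unfolding \<Lambda>_def using K0 \<open>M \<ge> 0\<close> H(1) by (intro sum_nonneg add_nonneg_nonneg mult_nonneg_nonneg)
  moreover have "\<bar>u i x - u i y\<bar> \<le> \<Lambda> * \<bar>x - y\<bar>" for i x y
  proof -
    have "norm (u i x - u i y) \<le> \<Lambda> * norm (x - y)"
    proof (rule field_differentiable_bound[of UNIV])
      show "(u i has_field_derivative (- c i t * u i t + F u i t)) (at t within UNIV)" for t
        using u unfolding solves_def by simp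
      show "norm (- c i t * u i t + F u i t) \<le> \<Lambda>" for t
      proof -
        have "\<bar>c i t * u i t\<bar> \<le> K i * M" unfolding abs_mult by (intro mult_mono K M K0) auto
        then have "\<bar>- c i t * u i t + F u i t\<bar> \<le> K i * M + H" using H(2)[of u i t] by linarith
        also have "\<dots> \<le> \<Lambda>"
          unfolding \<Lambda>_def using K0 \<open>M \<ge> 0\<close> H(1)
          by (intro member_le_sum add_nonneg_nonneg mult_nonneg_nonneg) auto
        finally show ?thesis by simp
      qed
    qed auto
    then show ?thesis by simp
  qed
  ultimately show ?thesis by (rule that)
qed

text \<open>\<open>T\<close> is a common almost period of the coefficients; the Lipschitz constant \<open>\<Lambda>\<close> of the solution
  absorbs the change of the delays.\<close>

lemma forcing_translate:
  assumes u: "\<And>t. in_sector u t"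
    and \<Lambda>: "\<Lambda> \<ge> 0" "\<And>i x y. \<bar>u i x - u i y\<bar> \<le> \<Lambda> * \<bar>x - y\<bar>"
    and T: "\<And>i j l t. \<bar>a i j l (t + T) - a i j l t\<bar> \<le> \<epsilon>" "\<And>i j l t. \<bar>\<tau> i j l (t + T) - \<tau> i j l t\<bar> \<le> \<epsilon>"
      "\<And>i t. \<bar>J i (t + T) - J i t\<bar> \<le> \<epsilon>"
    and D: "\<And>i t. \<bar>u i (t + T) - u i t\<bar> \<le> D * \<xi> i"
  shows "\<bar>F u i (t + T) - F u i t\<bar> \<le> D * G i + \<epsilon> * ((\<Sum>l\<in>UNIV. \<Sum>j\<in>UNIV. B j + A i j l * s j * \<Lambda>) + 1)"
proof -
  define x y where "x j l = u j (t + T - \<tau> i j l (t + T))" and "y j l = u j (t - \<tau> i j l t)" for j l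
  have termwise: "\<bar>a i j l (t + T) * g j (\<sigma> j * x j l) - a i j l t * g j (\<sigma> j * y j l)\<bar> \<le>
    A i j l * s j * (D * \<xi> j) + \<epsilon> * (B j + A i j l * s j * \<Lambda>)" for j l
  proof -
    have "\<bar>x j l - u j (t - \<tau> i j l t + T)\<bar> \<le> \<Lambda> * \<bar>\<tau> i j l (t + T) - \<tau> i j l t\<bar>"
      unfolding x_def using \<Lambda>(2)[of j "t + T - \<tau> i j l (t + T)" "t - \<tau> i j l t + T"]
      by (simp add: abs_minus_commute)
    also have "\<dots> \<le> \<Lambda> * \<epsilon>" by (intro mult_left_mono \<Lambda> T)
    finally have "\<bar>x j l - y j l\<bar> \<le> \<Lambda> * \<epsilon> + D * \<xi> j"
      unfolding y_def using D[of j "t - \<tau> i j l t"] by linarith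
    then have "s j * \<bar>x j l - y j l\<bar> \<le> s j * (\<Lambda> * \<epsilon> + D * \<xi> j)" by (intro mult_left_mono s_nonneg)
    moreover have "\<bar>g j (\<sigma> j * x j l) - g j (\<sigma> j * y j l)\<bar> \<le> s j * \<bar>x j l - y j l\<bar>"
      unfolding x_def y_def using u by (intro g_lip) (auto simp: in_sector_def)
    ultimately have "\<bar>g j (\<sigma> j * x j l) - g j (\<sigma> j * y j l)\<bar> \<le> s j * (\<Lambda> * \<epsilon> + D * \<xi> j)" by linarith
    then have "\<bar>a i j l t * (g j (\<sigma> j * x j l) - g j (\<sigma> j * y j l))\<bar> \<le> A i j l * (s j * (\<Lambda> * \<epsilon> + D * \<xi> j))"
      unfolding abs_mult by (intro mult_mono a_le A_nonneg) auto
    moreover have "\<bar>(a i j l (t + T) - a i j l t) * g j (\<sigma> j * x j l)\<bar> \<le> \<epsilon> * B j"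
      unfolding abs_mult using T(1)[of i j l t] by (intro mult_mono g_le) auto
    moreover have "a i j l (t + T) * g j (\<sigma> j * x j l) - a i j l t * g j (\<sigma> j * y j l) =
      (a i j l (t + T) - a i j l t) * g j (\<sigma> j * x j l) + a i j l t * (g j (\<sigma> j * x j l) - g j (\<sigma> j * y j l))"
      by (simp add: algebra_simps)
    moreover have "A i j l * (s j * (\<Lambda> * \<epsilon> + D * \<xi> j)) + \<epsilon> * B j =
      A i j l * s j * (D * \<xi> j) + \<epsilon> * (B j + A i j l * s j * \<Lambda>)" by (simp add: algebra_simps)
    ultimately show ?thesis by linarith
  qed
  have "F u i (t + T) - F u i t =
    (\<Sum>l\<in>UNIV. \<Sum>j\<in>UNIV. a i j l (t + T) * g j (\<sigma> j * x j l) - a i j l t * g j (\<sigma> j * y j l)) +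
    (J i (t + T) - J i t)"
    by (simp add: forcing_def x_def y_def sum_subtractf)
  moreover have "\<bar>\<Sum>l\<in>UNIV. \<Sum>j\<in>UNIV. a i j l (t + T) * g j (\<sigma> j * x j l) - a i j l t * g j (\<sigma> j * y j l)\<bar> \<le>
    (\<Sum>l\<in>UNIV. \<Sum>j\<in>UNIV. \<bar>a i j l (t + T) * g j (\<sigma> j * x j l) - a i j l t * g j (\<sigma> j * y j l)\<bar>)"
    by (rule order_trans[OF sum_abs]) (intro sum_mono sum_abs)
  moreover have "\<dots> \<le> (\<Sum>l\<in>UNIV. \<Sum>j\<in>UNIV. A i j l * s j * (D * \<xi> j) + \<epsilon> * (B j + A i j l * s j * \<Lambda>))"
    by (intro sum_mono termwise)
  moreover have "\<dots> = D * G i + \<epsilon> * (\<Sum>l\<in>UNIV. \<Sum>j\<in>UNIV. B j + A i j l * s j * \<Lambda>)"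
    unfolding sum_distrib_left sum.distrib[symmetric] by (intro sum.cong refl) (simp add: mult_ac)
  ultimately have "\<bar>F u i (t + T) - F u i t\<bar> \<le> D * G i + \<epsilon> * (\<Sum>l\<in>UNIV. \<Sum>j\<in>UNIV. B j + A i j l * s j * \<Lambda>) + \<epsilon>"
    using T(3)[of i t] by linarith
  then show ?thesis by (simp add: distrib_left)
qed

lemma entire_solution_almost_periodic:
  assumes u: "solves UNIV u u" "\<And>t. in_sector u t" and M: "\<And>i t. \<bar>u i t\<bar> \<le> M"
  shows "almost_periodic (u i)"
  unfolding almost_periodic_def
proof (intro conjI allI impI)
  show "continuous_on UNIV (u i)"
    using u(1) unfolding solves_def by (intro DERIV_continuous_on) auto
  fix \<epsilon> :: real assume "\<epsilon> > 0"
  obtain \<theta> where \<theta>: "0 \<le> \<theta>" "\<theta> < 1" "\<And>i. G i \<le> \<theta> * (c0 i * \<xi> i)" using contraction_factor by blast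
  obtain \<Lambda> where \<Lambda>: "\<Lambda> \<ge> 0" "\<And>i x y. \<bar>u i x - u i y\<bar> \<le> \<Lambda> * \<bar>x - y\<bar>"
    using solution_lipschitz[OF u(1) M] by blast
  have "M \<ge> 0" using M[of undefined 0] by linarith
  \<comment> \<open>\<open>\<delta> * Q i\<close> will bound all that a common almost period changes
    in row \<open>i\<close>: \<open>M\<close> accounts for the change of \<open>c\<close>, the rest
    is the constant of \<open>forcing_translate\<close>.\<close>
  define Q where "Q i = M + ((\<Sum>l\<in>UNIV. \<Sum>j\<in>UNIV. B j + A i j l * s j * \<Lambda>) + 1)" for i
  have Q0: "Q i \<ge> 0" for i
    unfolding Q_def using \<open>M \<ge> 0\<close> \<Lambda>(1) B_nonneg A_nonneg s_nonneg
    by (intro add_nonneg_nonneg sum_nonneg mult_nonneg_nonneg) auto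
  have cx: "c0 i * \<xi> i > 0" for i using c0_pos \<xi>_pos by simp
  define P where "P = (\<Sum>i\<in>UNIV. Q i / (c0 i * \<xi> i))"
  have P0: "P \<ge> 0" unfolding P_def using Q0 less_imp_le[OF cx] by (intro sum_nonneg divide_nonneg_nonneg)
  have "Q i / (c0 i * \<xi> i) \<le> P" for i
    unfolding P_def using Q0 less_imp_le[OF cx] by (intro member_le_sum divide_nonneg_nonneg) auto
  then have P: "Q i \<le> P * (c0 i * \<xi> i)" for i using cx by (simp add: pos_divide_le_eq)
  \<comment> \<open>Chosen so that the final bound
    \<open>\<delta> * P / (1 - \<theta>) * \<xi> i\<close> becomes
    \<open>\<epsilon> * (P / (P + 1))\<close>; the \<open>+ 1\<close> makes it strictly smaller than
    \<open>\<epsilon>\<close> and keeps the denominator positive.\<close>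
  define \<delta> where "\<delta> = \<epsilon> * (1 - \<theta>) / ((P + 1) * \<xi> i)"
  have \<delta>: "\<delta> > 0" unfolding \<delta>_def using \<open>\<epsilon> > 0\<close> \<theta>(2) P0 \<xi>_pos[of i] by simp
  define \<F> where "\<F> = range c \<union> range J \<union> range (\<lambda>(i, j, l). a i j l) \<union> range (\<lambda>(i, j, l). \<tau> i j l)"
  have mem: "c i \<in> \<F>" "J i \<in> \<F>" "a i j l \<in> \<F>" "\<tau> i j l \<in> \<F>" for i j l
    unfolding \<F>_def by (auto intro: image_eqI[where x = "(i, j, l)"])
  have "relatively_dense {T. \<forall>f\<in>\<F>. \<forall>t. \<bar>f (t + T) - f t\<bar> < \<delta>}"
    by (rule common_almost_periods) (use \<delta> ap_c ap_J ap_a ap_\<tau> in \<open>auto simp: \<F>_def\<close>)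
  moreover have "{T. \<forall>f\<in>\<F>. \<forall>t. \<bar>f (t + T) - f t\<bar> < \<delta>} \<subseteq> {T. \<forall>t. \<bar>u i (t + T) - u i t\<bar> < \<epsilon>}"
  proof (intro subsetI CollectI allI)
    fix T t assume "T \<in> {T. \<forall>f\<in>\<F>. \<forall>t. \<bar>f (t + T) - f t\<bar> < \<delta>}"
    then have T: "\<bar>c i (t + T) - c i t\<bar> \<le> \<delta>" "\<bar>J i (t + T) - J i t\<bar> \<le> \<delta>"
      "\<bar>a i j l (t + T) - a i j l t\<bar> \<le> \<delta>" "\<bar>\<tau> i j l (t + T) - \<tau> i j l t\<bar> \<le> \<delta>" for i j l t
      using mem by (auto intro: less_imp_le)
    have bd: "\<bar>u i (t + T) - u i t\<bar> \<le> M + M" for i t using M[of i t] M[of i "t + T"] by linarith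
    have "\<bar>u i (t + T) - u i t\<bar> \<le> \<delta> * P / (1 - \<theta>) * \<xi> i"
    proof (rule weighted_sup_bound[where w = "\<lambda>i t. u i (t + T) - u i t", OF bd \<theta>(2)])
      fix D i t assume D: "D \<ge> 0" "\<And>i t. \<bar>u i (t + T) - u i t\<bar> \<le> D * \<xi> i"
      \<comment> \<open>The translate satisfies the equation with the untranslated \<open>c\<close>,
        at the price of the extra forcing \<open>(c i t - c i (t + T)) * u i (t + T)\<close>. This
        makes the difference a solution of one linear equation.\<close>
      show "\<bar>u i (t + T) - u i t\<bar> \<le> (\<theta> * D + \<delta> * P) * \<xi> i"
      proof (rule linear_abs_bound_line[where y = "\<lambda>t. u i (t + T) - u i t"
            and h = "\<lambda>t. (c i t - c i (t + T)) * u i (t + T) + (F u i (t + T) - F u i t)",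
            OF c_cont[of i] c0_pos c0_le _ _ bd])
        fix t
        have d: "(u i has_real_derivative (- c i t * u i t + F u i t)) (at t)" for t
          using u(1) unfolding solves_def by simp
        show "((\<lambda>t. u i (t + T) - u i t) has_real_derivative - c i t * (u i (t + T) - u i t) +
          ((c i t - c i (t + T)) * u i (t + T) + (F u i (t + T) - F u i t))) (at t)"
          using DERIV_diff[OF DERIV_shift[THEN iffD1, OF d[of "t + T"]] d[of t]]
          by (simp add: algebra_simps)
        have "\<bar>(c i t - c i (t + T)) * u i (t + T)\<bar> \<le> \<delta> * M"
          unfolding abs_mult using T(1)[of i t] by (intro mult_mono M) auto
        moreover have "\<bar>F u i (t + T) - F u i t\<bar> \<le> D * G i +
          \<delta> * ((\<Sum>l\<in>UNIV. \<Sum>j\<in>UNIV. B j + A i j l * s j * \<Lambda>) + 1)"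
          by (rule forcing_translate[OF u(2) \<Lambda> T(3) T(4) T(2) D(2)])
        ultimately have "\<bar>(c i t - c i (t + T)) * u i (t + T) + (F u i (t + T) - F u i t)\<bar> \<le> D * G i + \<delta> * Q i"
          unfolding Q_def by (simp add: distrib_left)
        also have "\<dots> \<le> D * (\<theta> * (c0 i * \<xi> i)) + \<delta> * (P * (c0 i * \<xi> i))"
          using \<delta> by (intro add_mono mult_left_mono \<theta> P D) auto
        also have "\<dots> = c0 i * ((\<theta> * D + \<delta> * P) * \<xi> i)" by (simp add: algebra_simps)
        also have "\<dots> \<le> c i t * ((\<theta> * D + \<delta> * P) * \<xi> i)"
          using \<theta>(1) D(1) P0 \<delta> less_imp_le[OF \<xi>_pos]
          by (intro mult_right_mono c0_le mult_nonneg_nonneg add_nonneg_nonneg) auto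
        finally show "\<bar>(c i t - c i (t + T)) * u i (t + T) + (F u i (t + T) - F u i t)\<bar> \<le>
          c i t * ((\<theta> * D + \<delta> * P) * \<xi> i)" .
      qed
    qed
    also have "\<dots> = \<epsilon> * (P / (P + 1))"
      unfolding \<delta>_def using \<theta>(2) \<xi>_pos[of i] P0 by simp
    also have "\<dots> < \<epsilon> * 1" using \<open>\<epsilon> > 0\<close> P0 by (intro mult_strict_left_mono) auto
    finally show "\<bar>u i (t + T) - u i t\<bar> < \<epsilon>" by simp
  qed
  ultimately show "relatively_dense {T. \<forall>t. \<bar>u i (t + T) - u i t\<bar> < \<epsilon>}"
    unfolding relatively_dense_def by (meson subsetD)
qed

section \<open>Return to vector-valued solutions and stability\<close>

lemma gnn_solution_solves:
  "gnn_solution c a g \<sigma> \<tau> J U \<longleftrightarrow> solves UNIV (\<lambda>i t. U t $ i) (\<lambda>i t. U t $ i)"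
  unfolding gnn_solution_def solves_def gnn_rhs_forcing by auto

lemma solves_subset: "solves UNIV u v \<Longrightarrow> solves W u v"
  unfolding solves_def by (meson DERIV_subset UNIV_I subset_UNIV)

text \<open>\<open>K\<close> enters only through its description by the sector, so every choice of
  \<open>\<Sigma>\<close> is handled by the same argument.\<close>

lemma exp_stable_in_sector:
  fixes K :: "(real \<Rightarrow> real ^ 'n) set"
  assumes K: "\<And>\<phi>. \<phi> \<in> K \<longleftrightarrow> (\<forall>i. continuous_on {-k..0} (\<lambda>s. \<phi> s $ i)) \<and>
      (\<forall>s\<in>{-k..0}. in_sector (\<lambda>i t. \<phi> t $ i) s)"
    and k: "max_delay \<kappa> = k"
    and U: "gnn_solution c a g \<sigma> \<tau> J U" "\<And>t. in_sector (\<lambda>i t. U t $ i) t"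
  shows "exp_stable_in c a g \<sigma> \<tau> \<kappa> J K U"
  unfolding exp_stable_in_def k
proof (intro conjI allI)
  define u where "u i t = U t $ i" for i t
  have u: "solves UNIV u u" "\<And>t. in_sector u t"
    using U unfolding gnn_solution_solves u_def by auto
  have u_cont: "continuous_on S (u i)" for i S
    using u(1) unfolding solves_def by (meson DERIV_isCont UNIV_I continuous_at_imp_continuous_on)
  show "segment U t \<in> K" for t
    unfolding K
  proof (intro conjI allI ballI)
    show "continuous_on {-k..0} (\<lambda>s. segment U t s $ i)" for i
      unfolding segment_def u_def[symmetric]
      by (intro continuous_on_compose2[OF u_cont[of UNIV]] continuous_intros) auto
    show "in_sector (\<lambda>i r. segment U t r $ i) s" for s
      using U(2)[of "t + s"] by (simp add: in_sector_def segment_def)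
  qed
  obtain \<mu> where \<mu>: "\<mu> > 0" "\<And>i. exp (\<mu> * k) * G i \<le> (c0 i - \<mu>) * \<xi> i" using decay_rate by blast
  \<comment> \<open>The ratio \<open>hi / lo\<close> converts the estimate from the norm weighted by
    \<open>\<xi>\<close> to the plain maximum norm and serves as \<open>\<rho>\<close>.\<close>
  define lo hi where "lo = Min (range \<xi>)" and "hi = Max (range \<xi>)"
  have lo: "lo > 0" "\<And>i. lo \<le> \<xi> i" unfolding lo_def using \<xi>_pos by (auto simp: Min_gr_iff)
  have hi: "\<And>i. \<xi> i \<le> hi" unfolding hi_def by auto
  have "hi / lo \<ge> 1" using lo(1) order_trans[OF lo(2) hi] by simp
  moreover have "\<forall>\<phi>\<in>K. (\<exists>v. gnn_ivp_solution c a g \<sigma> \<tau> \<kappa> J \<phi> v) \<and>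
    (\<forall>v. gnn_ivp_solution c a g \<sigma> \<tau> \<kappa> J \<phi> v \<longrightarrow> (\<forall>t\<ge>0. (MAX i. \<bar>U t $ i - v t $ i\<bar>)
      \<le> hi / lo * exp (- \<mu> * t) * history_norm k (\<lambda>s. segment U 0 s - \<phi> s)))"
  proof (intro conjI ballI allI impI)
    fix \<phi> assume \<phi>: "\<phi> \<in> K"
    then have \<phi>': "\<And>i. continuous_on {-k..0} (\<lambda>s. \<phi> s $ i)"
      "\<And>s. s \<in> {-k..0} \<Longrightarrow> in_sector (\<lambda>i t. \<phi> t $ i) s" unfolding K by auto
    obtain v where v: "\<And>i. continuous_on UNIV (v i)" "\<And>i t. t \<in> {-k..0} \<Longrightarrow> v i t = \<phi> t $ i"
      "solves {0..} v v"
      using ivp_solution[of "\<lambda>i t. \<phi> t $ i", OF \<phi>'] by blast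
    have "gnn_ivp_solution c a g \<sigma> \<tau> \<kappa> J \<phi> (\<lambda>t. \<chi> i. v i t)"
      unfolding gnn_ivp_solution_def k gnn_rhs_forcing
    proof (intro conjI ballI allI impI)
      show "continuous_on {-k..} (\<lambda>t. \<chi> i. v i t)"
        by (intro continuous_on_vec_lambda continuous_on_subset[OF v(1)]) auto
      show "(\<chi> i. v i s) = \<phi> s" if "s \<in> {-k..0}" for s using v(2)[OF that] by (simp add: vec_eq_iff)
      show "((\<lambda>s. (\<chi> i. v i s) $ i) has_real_derivative
        - c i t * (\<chi> i. v i t) $ i + F (\<lambda>i t. (\<chi> i. v i t) $ i) i t) (at t within {0..})"
        if "0 \<le> t" for t i
        using v(3) that unfolding solves_def by simp
    qed
    then show "\<exists>v. gnn_ivp_solution c a g \<sigma> \<tau> \<kappa> J \<phi> v" by blast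
    fix V and t :: real
    assume V: "gnn_ivp_solution c a g \<sigma> \<tau> \<kappa> J \<phi> V" and t: "t \<ge> 0"
    define v where "v i t = V t $ i" for i t
    have v: "\<And>i. continuous_on {-k..} (v i)" "\<And>s i. s \<in> {-k..0} \<Longrightarrow> v i s = \<phi> s $ i" "solves {0..} v v"
      using V unfolding gnn_ivp_solution_def k gnn_rhs_forcing solves_def v_def
      by (auto intro: continuous_intros)
    have v_init: "in_sector v s" if "s \<in> {-k..0}" for s
      using \<phi>'(2)[OF that] v(2)[OF that] by (simp add: in_sector_def)
    have v_sec: "in_sector v s" if "s \<ge> - k" for s
      by (rule sector_invariant[OF v(1) v(3) v_init that])
    define N where "N = history_norm k (\<lambda>s. segment U 0 s - \<phi> s)"
    have N: "\<bar>u i s - v i s\<bar> \<le> N" if "s \<in> {-k..0}" for i s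
    proof -
      have "\<bar>(segment U 0 s - \<phi> s) $ i\<bar> \<le> N"
        unfolding N_def
      proof (rule abs_le_history_norm[OF _ that])
        show "continuous_on {-k..0} (\<lambda>s. (segment U 0 s - \<phi> s) $ i)" for i
          using u_cont[of "{-k..0}" i] \<phi>'(1)[of i] by (simp add: segment_def u_def continuous_on_diff)
      qed
      then show ?thesis by (simp add: segment_def u_def v(2)[OF that])
    qed
    have "N \<ge> 0" using N[of 0 undefined] k_pos by (smt (verit) atLeastAtMost_iff)
    have est: "\<bar>u i t - v i t\<bar> \<le> hi / lo * exp (- \<mu> * t) * N" for i
    proof -
      have "\<forall>i. \<bar>u i t - v i t\<bar> \<le> N / lo * exp (- \<mu> * t) * \<xi> i"
      proof (rule exponential_estimate[OF \<mu> u_cont solves_subset[OF u(1)] u(2) v(1) v(3) v_sec])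
        show "N / lo \<ge> 0" using \<open>N \<ge> 0\<close> lo(1) by simp
        show "\<bar>u i s - v i s\<bar> \<le> N / lo * \<xi> i" if "s \<in> {-k..0}" for i s
        proof -
          have "N * lo \<le> N * \<xi> i" by (intro mult_left_mono lo \<open>N \<ge> 0\<close>)
          then have "N \<le> N / lo * \<xi> i" using lo(1) by (simp add: pos_le_divide_eq)
          then show ?thesis using N[OF that, of i] by linarith
        qed
      qed (use t k_pos in auto)
      then have "\<bar>u i t - v i t\<bar> \<le> N / lo * exp (- \<mu> * t) * \<xi> i" by blast
      also have "\<dots> \<le> N / lo * exp (- \<mu> * t) * hi"
        using \<open>N \<ge> 0\<close> lo(1) by (intro mult_left_mono hi) auto
      finally show ?thesis by (simp add: mult_ac)
    qed
    have "(MAX i. \<bar>u i t - v i t\<bar>) \<le> hi / lo * exp (- \<mu> * t) * N"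
      by (subst Max_le_iff) (use est in auto)
    then show "(MAX i. \<bar>U t $ i - V t $ i\<bar>) \<le>
      hi / lo * exp (- \<mu> * t) * history_norm k (\<lambda>s. segment U 0 s - \<phi> s)"
      unfolding u_def v_def N_def .
  qed
  ultimately show "\<exists>\<rho>\<ge>1. \<exists>\<mu>>0. \<forall>\<phi>\<in>K. (\<exists>v. gnn_ivp_solution c a g \<sigma> \<tau> \<kappa> J \<phi> v) \<and>
    (\<forall>v. gnn_ivp_solution c a g \<sigma> \<tau> \<kappa> J \<phi> v \<longrightarrow> (\<forall>t\<ge>0. (MAX i. \<bar>U t $ i - v t $ i\<bar>)
      \<le> \<rho> * exp (- \<mu> * t) * history_norm k (\<lambda>s. segment U 0 s - \<phi> s)))"
    using \<mu>(1) by blast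
qed

text \<open>A competitor is bounded because it is almost periodic, and lies in the sector because
  stability puts its segments into \<open>K\<close> (evaluated at 0). So
  \<open>entire_solution_unique\<close> applies to it.\<close>

lemma unique_exp_stable_solution:
  fixes K :: "(real \<Rightarrow> real ^ 'n) set"
  assumes K: "\<And>\<phi>. \<phi> \<in> K \<longleftrightarrow> (\<forall>i. continuous_on {-k..0} (\<lambda>s. \<phi> s $ i)) \<and>
      (\<forall>s\<in>{-k..0}. in_sector (\<lambda>i t. \<phi> t $ i) s)"
    and k: "max_delay \<kappa> = k"
  shows "\<exists>!U. almost_periodic_vec U \<and> gnn_solution c a g \<sigma> \<tau> J U \<and> exp_stable_in c a g \<sigma> \<tau> \<kappa> J K U"
proof -
  obtain u M where u: "solves UNIV u u" "\<And>t. in_sector u t" "\<And>i t. \<bar>u i t\<bar> \<le> M"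
    using entire_solution by blast
  define U :: "real \<Rightarrow> real ^ 'n" where "U t = (\<chi> i. u i t)" for t
  have Uu: "(\<lambda>i t. U t $ i) = u" by (simp add: U_def)
  have sol: "gnn_solution c a g \<sigma> \<tau> J U" unfolding gnn_solution_solves Uu by (rule u(1))
  show ?thesis
  proof (rule ex1I[of _ U], intro conjI sol)
    show "almost_periodic_vec U"
      unfolding almost_periodic_vec_def U_def using entire_solution_almost_periodic[OF u] by simp
    show "exp_stable_in c a g \<sigma> \<tau> \<kappa> J K U"
      by (rule exp_stable_in_sector[OF K k sol]) (simp add: Uu u(2))
  next
    fix W
    assume W: "almost_periodic_vec W \<and> gnn_solution c a g \<sigma> \<tau> J W \<and> exp_stable_in c a g \<sigma> \<tau> \<kappa> J K W"
    define w where "w i t = W t $ i" for i t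
    have "\<exists>C. \<forall>t. \<bar>w i t\<bar> \<le> C" for i
      using W almost_periodic_bounded unfolding almost_periodic_vec_def w_def by metis
    then obtain C where C: "\<And>i t. \<bar>w i t\<bar> \<le> C i" by metis
    have "C i \<ge> 0" for i using C[of i 0] by linarith
    then have "C i \<le> (\<Sum>i\<in>UNIV. C i)" for i by (intro member_le_sum) auto
    then have wM: "\<bar>w i t\<bar> \<le> max M (\<Sum>i\<in>UNIV. C i)" for i t
      using C[of i t] by (meson max.coboundedI2 order_trans)
    have "u = w"
    proof (rule entire_solution_unique[OF u(1) _ u(2) _ _ wM])
      show "solves UNIV w w" using W unfolding gnn_solution_solves w_def by blast
      show "in_sector w t" for t
      proof -
        have "segment W t \<in> K" using W unfolding exp_stable_in_def by blast
        then have "in_sector (\<lambda>i s. segment W t s $ i) 0" unfolding K using k_pos by auto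
        then show ?thesis by (simp add: in_sector_def segment_def w_def)
      qed
      show "\<bar>u i t\<bar> \<le> max M (\<Sum>i\<in>UNIV. C i)" for i t using u(3)[of i t] by linarith
    qed
    then show "W = U" by (auto simp: U_def w_def vec_eq_iff)
  qed
qed

end

section \<open>Activation functions of class A\<close>

lemma class_A_deriv:
  assumes "class_A f B"
  shows "(f has_real_derivative deriv f x) (at x)"
    and "(deriv f has_real_derivative deriv (deriv f) x) (at x)"
  using assms unfolding class_A_def by (auto simp: DERIV_deriv_iff_real_differentiable)

lemma class_A_deriv_mono:
  assumes f: "class_A f B"
  shows "x < y \<Longrightarrow> y \<le> 0 \<Longrightarrow> deriv f x < deriv f y"
    and "0 \<le> x \<Longrightarrow> x < y \<Longrightarrow> deriv f y < deriv f x"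
proof -
  have sgn: "x * deriv (deriv f) x < 0" if "x \<noteq> 0" for x using f that unfolding class_A_def by blast
  have cont: "continuous_on S (deriv f)" for S
    using class_A_deriv(2)[OF f] by (meson DERIV_isCont continuous_at_imp_continuous_on)
  show "deriv f x < deriv f y" if "x < y" "y \<le> 0"
  proof (rule DERIV_pos_imp_increasing_open[OF that(1) _ cont])
    fix z assume "x < z" "z < y"
    then have "deriv (deriv f) z > 0" using sgn[of z] that by (simp add: mult_less_0_iff)
    then show "\<exists>d. (deriv f has_real_derivative d) (at z) \<and> d > 0" using class_A_deriv(2)[OF f] by blast
  qed
  show "deriv f y < deriv f x" if "0 \<le> x" "x < y"
  proof (rule DERIV_neg_imp_decreasing_open[OF that(2) _ cont])
    fix z assume "x < z" "z < y"
    then have "deriv (deriv f) z < 0" using sgn[of z] that by (simp add: mult_less_0_iff)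
    then show "\<exists>d. (deriv f has_real_derivative d) (at z) \<and> d < 0" using class_A_deriv(2)[OF f] by blast
  qed
qed

lemma class_A_strict_mono:
  assumes f: "class_A f B" and "x < y"
  shows "f x < f y"
  by (rule DERIV_pos_imp_increasing[OF \<open>x < y\<close>])
     (use f class_A_deriv(1)[OF f] in \<open>unfold class_A_def, blast\<close>)

text \<open>A slope of at least \<open>q\<close> over length \<open>L\<close> would make
  \<open>f\<close> grow by \<open>L * q = 2 * B + 1\<close>, while \<open>f\<close> varies by at
  most \<open>2 * B\<close>. The mean value theorem on either side of 0 supplies the points.\<close>

lemma class_A_deriv_small:
  assumes f: "class_A f B" and "q > 0"
  shows "\<exists>x<0. deriv f x < q" and "\<exists>x>0. deriv f x < q"
proof -
  have bd: "\<bar>f x\<bar> \<le> B" for x using f unfolding class_A_def by blast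
  have "B \<ge> 0" using bd[of 0] by linarith
  define L where "L = (2 * B + 1) / q"
  have L: "L > 0" "L * q = 2 * B + 1" unfolding L_def using \<open>B \<ge> 0\<close> \<open>q > 0\<close> by auto
  have small: "deriv f z < q" if "f y - f x = (y - x) * deriv f z" "y - x = L" for x y z
  proof (rule ccontr)
    assume "\<not> deriv f z < q"
    then have "L * q \<le> L * deriv f z" using L(1) by (intro mult_left_mono) auto
    then show False using that bd[of x] bd[of y] L(2) by auto
  qed
  obtain z where "- L < z" "z < 0" "f 0 - f (- L) = (0 - - L) * deriv f z"
    using MVT2[of "- L" 0 f "deriv f"] class_A_deriv(1)[OF f] L(1) by auto
  then show "\<exists>x<0. deriv f x < q" using small[of 0 "- L" z] by auto
  obtain z where "0 < z" "z < L" "f L - f 0 = (L - 0) * deriv f z"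
    using MVT2[of 0 L f "deriv f"] class_A_deriv(1)[OF f] L(1) by auto
  then show "\<exists>x>0. deriv f x < q" using small[of L 0 z] by auto
qed

lemma class_A_deriv_level:
  assumes f: "class_A f B" and q: "0 < q" "q < deriv f 0"
  shows "\<exists>!x. deriv f x = q \<and> x < 0" and "\<exists>!x. deriv f x = q \<and> x > 0"
proof -
  have cont: "continuous_on S (deriv f)" for S
    using class_A_deriv(2)[OF f] by (meson DERIV_isCont continuous_at_imp_continuous_on)
  obtain x where x: "x < 0" "deriv f x < q" using class_A_deriv_small(1)[OF f q(1)] by blast
  obtain z where "x \<le> z" "z \<le> 0" "deriv f z = q"
    using IVT'[of "deriv f" x q 0] x q cont by auto
  then have "deriv f z = q \<and> z < 0" using q(2) by (cases "z = 0") auto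
  then show "\<exists>!x. deriv f x = q \<and> x < 0"
    using class_A_deriv_mono(1)[OF f] by (metis less_imp_le less_irrefl linorder_neqE_linordered_idom)
  obtain x where x: "x > 0" "deriv f x < q" using class_A_deriv_small(2)[OF f q(1)] by blast
  obtain z where "0 \<le> z" "z \<le> x" "deriv f z = q"
    using IVT2'[of "deriv f" x q 0] x q cont by auto
  then have "deriv f z = q \<and> z > 0" using q(2) by (cases "z = 0") auto
  then show "\<exists>!x. deriv f x = q \<and> x > 0"
    using class_A_deriv_mono(2)[OF f] by (metis less_imp_le less_irrefl linorder_neqE_linordered_idom)
qed

lemma class_A_deriv_le_0:
  assumes "class_A f B"
  shows "deriv f x \<le> deriv f 0"
  using class_A_deriv_mono(1)[OF assms, of x 0] class_A_deriv_mono(2)[OF assms, of 0 x]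
  by (cases x "0::real" rule: linorder_cases) auto

text \<open>\<open>z\<close> is the point of its ray closest to 0, where \<open>deriv f\<close> is
  largest on that ray. Applied at \<open>\<sigma> i * \<beta> i\<close> and
  \<open>\<sigma> i * \<alpha> i\<close>, this is where \<open>\<gamma>\<close> comes from.\<close>

lemma class_A_lipschitz:
  assumes f: "class_A f B" and "x \<le> z \<and> y \<le> z \<and> z \<le> 0 \<or> z \<le> x \<and> z \<le> y \<and> 0 \<le> z"
  shows "\<bar>f x - f y\<bar> \<le> deriv f z * \<bar>x - y\<bar>"
proof -
  have *: "\<bar>f x - f y\<bar> \<le> deriv f z * \<bar>x - y\<bar>"
    if "convex S" "x \<in> S" "y \<in> S" "\<And>w. w \<in> S \<Longrightarrow> deriv f w \<le> deriv f z" for S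
  proof -
    have "norm (f x - f y) \<le> deriv f z * norm (x - y)"
    proof (rule field_differentiable_bound[OF that(1) _ _ that(2,3)])
      show "(f has_field_derivative deriv f w) (at w within S)" for w
        using class_A_deriv(1)[OF f] by (rule has_field_derivative_at_within)
      show "norm (deriv f w) \<le> deriv f z" if "w \<in> S" for w
        using \<open>\<And>w. w \<in> S \<Longrightarrow> deriv f w \<le> deriv f z\<close>[OF that] f unfolding class_A_def
        by (simp add: less_imp_le)
    qed
    then show ?thesis by simp
  qed
  from assms(2) show ?thesis
  proof
    assume h: "x \<le> z \<and> y \<le> z \<and> z \<le> 0"
    show ?thesis
      by (rule *[of "{..z}"])
         (use h class_A_deriv_mono(1)[OF f] in \<open>auto simp: order_le_less\<close>)
  next
    assume h: "z \<le> x \<and> z \<le> y \<and> 0 \<le> z"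
    show ?thesis
      by (rule *[of "{z..}"])
         (use h class_A_deriv_mono(2)[OF f] in \<open>auto simp: order_le_less\<close>)
  qed
qed

text \<open>\<open>crit_pt\<close> is a definite description, so its sign is known only after
  existence and uniqueness. \<open>H1_A\<close> places \<open>q\<close> strictly between 0 and the
  maximal slope \<open>deriv (g i) 0\<close>, and critical points of \<open>aux_F\<close> are the
  \<open>z\<close> at which \<open>g i\<close> has slope \<open>q\<close> at
  \<open>\<sigma> i * z\<close>. The signs are needed for
  \<open>\<beta> i < 0 < \<alpha> i\<close>.\<close>

lemma crit_pt_sign:
  fixes i :: "'n::finite"
  assumes f: "class_A (g i) (B i)" and "\<sigma> i > 0"
    and C: "(SUP t. c i t) > 0" and I: "(INF t. \<Sum>l\<in>UNIV. a i i l t) \<ge> 0"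
    and H: "H1_A c a g \<sigma>"
  shows "crit_pt c a g \<sigma> i 1 < 0" and "crit_pt c a g \<sigma> i 2 > 0"
proof -
  define C I where "C = (SUP t. c i t)" and "I = (INF t. \<Sum>l\<in>UNIV. a i i l t)"
  define q where "q = C / (\<sigma> i * I)"
  have q: "(INF x. deriv (g i) x) < q" "q < (SUP x. deriv (g i) x)"
    using H unfolding H1_A_def q_def C_def I_def by auto
  have "(INF x. deriv (g i) x) \<ge> 0"
    using f unfolding class_A_def by (intro cINF_greatest) (auto intro: less_imp_le)
  then have "q > 0" using q(1) by linarith
  text \<open>\<open>I = 0\<close> would make \<open>q\<close> the junk value \<open>0\<close>.\<close>
  then have "I > 0" using I unfolding q_def I_def[symmetric] by (cases "I = 0") auto
  have "(SUP x. deriv (g i) x) \<le> deriv (g i) 0"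
    using class_A_deriv_le_0[OF f] by (intro cSUP_least) auto
  then have "q < deriv (g i) 0" using q(2) by linarith
  note level = class_A_deriv_level[OF f \<open>q > 0\<close> this]
  have "deriv (aux_F c a g \<sigma> i) z = - C + I * (deriv (g i) (\<sigma> i * z) * \<sigma> i)" for z
  proof (rule DERIV_imp_deriv)
    have "((\<lambda>z. g i (\<sigma> i * z)) has_real_derivative deriv (g i) (\<sigma> i * z) * \<sigma> i) (at z)"
      using DERIV_chain2[OF class_A_deriv(1)[OF f] DERIV_cmult_Id] .
    then have "((\<lambda>z. - C * z + I * g i (\<sigma> i * z)) has_real_derivative
      (- C + I * (deriv (g i) (\<sigma> i * z) * \<sigma> i))) (at z)"
      by (auto intro!: derivative_eq_intros)
    then show "(aux_F c a g \<sigma> i has_real_derivative - C + I * (deriv (g i) (\<sigma> i * z) * \<sigma> i)) (at z)"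
      unfolding aux_F_def C_def I_def .
  qed
  then have zero: "deriv (aux_F c a g \<sigma> i) z = 0 \<longleftrightarrow> deriv (g i) (\<sigma> i * z) = q" for z
    unfolding q_def \<open>\<And>z. deriv (aux_F c a g \<sigma> i) z = _\<close>
    using \<open>I > 0\<close> \<open>\<sigma> i > 0\<close> by (auto simp: field_simps)
  \<comment> \<open>The substitution \<open>x = \<sigma> i * z\<close> transfers unique solvability
    and respects the sign condition \<open>P\<close>.\<close>
  have scale: "\<exists>!z. deriv (g i) (\<sigma> i * z) = q \<and> P z"
    if ex: "\<exists>!x. deriv (g i) x = q \<and> P x" and P: "\<And>z. P (\<sigma> i * z) \<longleftrightarrow> P z" for P
  proof -
    obtain x where x: "deriv (g i) x = q" "P x" "\<And>y. deriv (g i) y = q \<Longrightarrow> P y \<Longrightarrow> y = x"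
      using ex by blast
    show ?thesis
    proof (rule ex1I[of _ "x / \<sigma> i"])
      show "deriv (g i) (\<sigma> i * (x / \<sigma> i)) = q \<and> P (x / \<sigma> i)"
        using x(1,2) P[of "x / \<sigma> i"] \<open>\<sigma> i > 0\<close> by simp
      show "z = x / \<sigma> i" if z: "deriv (g i) (\<sigma> i * z) = q \<and> P z" for z
      proof -
        have "\<sigma> i * z = x" using x(3)[of "\<sigma> i * z"] z P[of z] by blast
        then show ?thesis using \<open>\<sigma> i > 0\<close> by auto
      qed
    qed
  qed
  have "\<exists>!z. deriv (g i) (\<sigma> i * z) = q \<and> z < 0"
    using level(1) \<open>\<sigma> i > 0\<close> by (intro scale) (auto simp: mult_less_0_iff)
  from theI'[OF this] show "crit_pt c a g \<sigma> i 1 < 0" unfolding crit_pt_def zero by simp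
  have "\<exists>!z. deriv (g i) (\<sigma> i * z) = q \<and> z > 0"
    using level(2) \<open>\<sigma> i > 0\<close> by (intro scale) (auto simp: zero_less_mult_iff)
  from theI'[OF this] show "crit_pt c a g \<sigma> i 2 > 0" unfolding crit_pt_def zero by simp
qed

text \<open>The diagonal terms are kept exact, because the self-excitation of neuron
  \<open>i\<close> is what holds it beyond \<open>\<beta> i\<close> or \<open>\<alpha> i\<close>;
  only the other neurons are estimated by their bounds \<open>B j\<close>.\<close>

lemma forcing_cross_bound:
  fixes a :: "'n::finite \<Rightarrow> 'n \<Rightarrow> 'm::finite \<Rightarrow> real \<Rightarrow> real"
  assumes "\<And>j l. bdd_above (range (\<lambda>t. \<bar>a i j l t\<bar>))" "\<And>j x. \<bar>g j x\<bar> \<le> B j"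
  shows "\<bar>forcing a g \<sigma> \<tau> J u i t - (\<Sum>l\<in>UNIV. a i i l t * g i (\<sigma> i * u i (t - \<tau> i i l t))) - J i t\<bar>
    \<le> cross_bound a B i"
proof -
  let ?f = "\<lambda>j l. a i j l t * g j (\<sigma> j * u j (t - \<tau> i j l t))"
  have "(\<Sum>j\<in>UNIV. ?f j l) = ?f i l + (\<Sum>j\<in>UNIV - {i}. ?f j l)" for l
    by (rule sum.remove) auto
  then have "forcing a g \<sigma> \<tau> J u i t - (\<Sum>l\<in>UNIV. ?f i l) - J i t = (\<Sum>l\<in>UNIV. \<Sum>j\<in>UNIV - {i}. ?f j l)"
    by (simp add: forcing_def sum.distrib)
  moreover have "\<bar>\<Sum>l\<in>UNIV. \<Sum>j\<in>UNIV - {i}. ?f j l\<bar> \<le> (\<Sum>l\<in>UNIV. \<Sum>j\<in>UNIV - {i}. \<bar>?f j l\<bar>)"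
    by (rule order_trans[OF sum_abs]) (intro sum_mono sum_abs)
  moreover have "\<dots> \<le> cross_bound a B i"
    unfolding cross_bound_def abs_mult
  proof (intro sum_mono mult_mono assms(2))
    show "\<bar>a i j l t\<bar> \<le> (SUP t. \<bar>a i j l t\<bar>)" for j l by (rule cSUP_upper[OF UNIV_I assms(1)])
    then show "0 \<le> (SUP t. \<bar>a i j l t\<bar>)" for j l by (meson abs_ge_zero order_trans)
  qed auto
  ultimately show ?thesis by linarith
qed

theorem theorem4:
  fixes c :: "'n::finite \<Rightarrow> real \<Rightarrow> real"
    and a :: "'n \<Rightarrow> 'n \<Rightarrow> 'm::finite \<Rightarrow> real \<Rightarrow> real"
    and g :: "'n \<Rightarrow> real \<Rightarrow> real"
    and \<sigma> :: "'n \<Rightarrow> real"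
    and \<tau> :: "'n \<Rightarrow> 'n \<Rightarrow> 'm \<Rightarrow> real \<Rightarrow> real"
    and \<kappa> :: "'n \<Rightarrow> 'n \<Rightarrow> 'm \<Rightarrow> real"
    and J :: "'n \<Rightarrow> real \<Rightarrow> real"
    and B \<beta> \<alpha> :: "'n \<Rightarrow> real"
  assumes "\<And>i j l t. 0 < \<tau> i j l t \<and> \<tau> i j l t \<le> \<kappa> i j l"
    and "H1 c a \<sigma> \<tau> J"
    and "\<And>i. class_A (g i) (B i)"
    and "H1_A c a g \<sigma>"
    and "H2_A c a g \<sigma> J B"
    and "\<And>i. is_beta c a g \<sigma> J B i (\<beta> i)"
    and "\<And>i. is_alpha c a g \<sigma> J B i (\<alpha> i)"
    and "H4_A c a g \<sigma> \<beta> \<alpha>"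
  shows "\<forall>\<Sigma> :: 'n \<Rightarrow> nat. (\<forall>i. \<Sigma> i \<in> {1, 2}) \<longrightarrow>
           (\<exists>!u :: real \<Rightarrow> real ^ 'n.
              almost_periodic_vec u \<and>
              gnn_solution c a g \<sigma> \<tau> J u \<and>
              exp_stable_in c a g \<sigma> \<tau> \<kappa> J (basin (max_delay \<kappa>) \<beta> \<alpha> \<Sigma>) u)"
proof (intro allI impI)
  fix \<Sigma> :: "'n \<Rightarrow> nat"
  have ap: "\<And>i. almost_periodic (c i)" "\<And>i j l. almost_periodic (a i j l)"
    "\<And>i j l. almost_periodic (\<tau> i j l)" "\<And>i. almost_periodic (J i)"
    and \<sigma>: "\<And>j. \<sigma> j > 0" and c_pos: "\<And>i t. c i t > 0" and a_pos: "\<And>i l t. a i i l t > 0"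
    using assms(2) unfolding H1_def by auto
  note f = assms(3)
  have g_le: "\<bar>g j x\<bar> \<le> B j" and g_0: "g j 0 = 0" and g'_pos: "deriv (g j) x > 0" for j x
    using f unfolding class_A_def by auto

  define C I c0 A where "C i = (SUP t. c i t)" and "I i = (INF t. \<Sum>l\<in>UNIV. a i i l t)"
    and "c0 i = (INF t. c i t)" and "A i j l = (SUP t. \<bar>a i j l t\<bar>)" for i j l
  have c_le: "c i t \<le> C i" and c_ge: "c0 i \<le> c i t" for i t
    unfolding C_def c0_def using almost_periodic_bdd[OF ap(1)] by (auto intro: cSUP_upper cINF_lower)
  have J_le: "J i t \<le> (SUP t. J i t)" and J_ge: "(INF t. J i t) \<le> J i t" for i t
    using almost_periodic_bdd[OF ap(4)] by (auto intro: cSUP_upper cINF_lower)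
  have a_le: "\<bar>a i j l t\<bar> \<le> A i j l" for i j l t
    unfolding A_def using almost_periodic_bdd[OF ap(2)] by (auto intro: cSUP_upper)
  have A0: "A i j l \<ge> 0" for i j l using a_le[of i j l 0] by linarith
  have diag_pos: "0 \<le> (\<Sum>l\<in>UNIV. a i i l t)" for i t
    using a_pos by (intro sum_nonneg) (auto intro: less_imp_le)
  have I_le: "I i \<le> (\<Sum>l\<in>UNIV. a i i l t)" for i t
    unfolding I_def using diag_pos by (intro cINF_lower bdd_belowI2[of _ 0]) auto
  have "C i > 0" for i using c_pos[of i 0] c_le[of i 0] by linarith
  moreover have "I i \<ge> 0" for i unfolding I_def using diag_pos by (intro cINF_greatest) auto
  ultimately have crit: "crit_pt c a g \<sigma> i 1 < 0" "crit_pt c a g \<sigma> i 2 > 0" for i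
    using crit_pt_sign[of g i B \<sigma> c a, OF f \<sigma>] assms(4)
    unfolding C_def I_def by auto

  have \<beta>: "\<beta> i < 0" "- C i * \<beta> i + I i * g i (\<sigma> i * \<beta> i) + cross_bound a B i + (SUP t. J i t) = 0"
    and \<alpha>: "\<alpha> i > 0" "- C i * \<alpha> i + I i * g i (\<sigma> i * \<alpha> i) - cross_bound a B i + (INF t. J i t) = 0" for i
    using assms(6)[of i] assms(7)[of i] crit[of i]
    unfolding is_beta_def is_alpha_def aux_F_def C_def I_def by auto

  \<comment> \<open>The maximum over both basin ends makes the gain matrix independent of
    \<open>\<Sigma>\<close>.\<close>
  define \<gamma> where "\<gamma> i = max (deriv (g i) (\<sigma> i * \<beta> i)) (deriv (g i) (\<sigma> i * \<alpha> i))" for i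
  define s where "s i = \<sigma> i * \<gamma> i" for i
  have s_pos: "s i > 0" for i unfolding s_def \<gamma>_def using \<sigma> g'_pos by (simp add: less_max_iff_disj)

  obtain m :: nat and p :: real and d :: "'n \<Rightarrow> real" and h :: "nat \<Rightarrow> real"
    and q r :: "'n \<Rightarrow> 'm \<Rightarrow> nat \<Rightarrow> real"
    where p: "p > 1" and d': "\<forall>i. d i > 0" and h': "\<forall>k\<in>{1..m}. h k > 0"
      and hs: "(\<Sum>k=1..m. h k) = p - 1"
      and qr': "\<forall>j l. (\<Sum>k=1..m+1. q j l k) = 1 \<and> (\<Sum>k=1..m+1. r j l k) = 1"
      and H4': "\<forall>i. p * d i * c0 i > (\<Sum>l\<in>UNIV. \<Sum>j\<in>UNIV.
               d j * A j i l powr (p * r i l (m+1)) * s i powr (p * q i l (m+1)) +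
               (\<Sum>k=1..m. d i * h k * A i j l powr (p * r j l k / h k) * s j powr (p * q j l k / h k)))"
    using assms(8) unfolding H4_A_def Let_def A_def[symmetric] c0_def[symmetric] \<gamma>_def[symmetric] s_def[symmetric]
    by (elim exE conjE) (rule that; assumption)
  note d = d'[rule_format] and h = h'[rule_format] and qr = qr'[rule_format] and H4 = H4'[rule_format]
  \<comment> \<open>A positive almost periodic function can have infimum 0. Positivity of
    \<open>c0 i\<close> comes from the strict inequality in \<open>H4_A\<close>, whose smaller side
    is nonnegative.\<close>
  have c0_pos: "c0 i > 0" for i
  proof -
    have "0 \<le> (\<Sum>l\<in>UNIV. \<Sum>j\<in>UNIV.
       d j * A j i l powr (p * r i l (m+1)) * s i powr (p * q i l (m+1)) +
       (\<Sum>k=1..m. d i * h k * A i j l powr (p * r j l k / h k) * s j powr (p * q j l k / h k)))"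
      using d h by (intro sum_nonneg add_nonneg_nonneg mult_nonneg_nonneg) (auto intro: less_imp_le)
    then have "p * d i * c0 i > 0" using H4[of i] by linarith
    moreover have "p * d i > 0" using p d[of i] by simp
    ultimately show ?thesis by (simp only: zero_less_mult_pos)
  qed
  define K :: "real ^ 'n ^ 'n" where "K = (\<chi> i j. \<Sum>l\<in>UNIV. A i j l * s j)"
  have K: "(K *v w) $ i = (\<Sum>l\<in>UNIV. \<Sum>j\<in>UNIV. A i j l * s j * w $ j)" for w i
    unfolding K_def matrix_vector_mult_def by (simp add: sum_distrib_right) (rule sum.swap)
  obtain \<xi> where \<xi>: "\<And>i. \<xi> $ i > 0" "\<And>i. (K *v \<xi>) $ i < c0 i * \<xi> $ i"
  proof (rule nonneg_matrix_positive_supersolution[of K c0])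
    show "K $ i $ j \<ge> 0" for i j
      unfolding K_def using A0 less_imp_le[OF s_pos] by (auto intro!: sum_nonneg mult_nonneg_nonneg)
    show "w = 0" if "\<And>i. w $ i \<ge> 0" "\<And>i. c0 i * w $ i \<le> (K *v w) $ i" for w
      using gain_no_fixed_cone[OF p A0 s_pos d h hs qr[THEN conjunct1] qr[THEN conjunct2] H4, of "\<lambda>i. w $ i"] that
      unfolding K by (simp add: vec_eq_iff)
  qed (use c0_pos in auto)

  define e where "e i = (if \<Sigma> i = 1 then 1 else - 1 :: real)" for i
  define b where "b i = (if \<Sigma> i = 1 then \<beta> i else - \<alpha> i)" for i
  have delay: "\<tau> i j l t \<le> max_delay \<kappa>" for i j l t
  proof -
    have "finite {\<kappa> i j l |i j l. True}"
      by (rule finite_subset[of _ "range (\<lambda>(i, j, l). \<kappa> i j l)"]) (auto intro: image_eqI[where x = "(_, _, _)"])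
    then have "\<kappa> i j l \<le> max_delay \<kappa>" unfolding max_delay_def by (intro Max_ge) auto
    then show ?thesis using assms(1)[of i j l t] by linarith
  qed
  interpret gnn_sector c a g \<sigma> \<tau> J "max_delay \<kappa>" A B c0 s "\<lambda>i. \<xi> $ i" e b
  proof (unfold_locales; (fact ap g_le c0_pos c_ge a_le delay \<xi>(1) \<xi>(2)[unfolded K] | succeed))
    show "continuous_on UNIV (g j)" for j
      using class_A_deriv(1)[OF f] by (meson DERIV_isCont continuous_at_imp_continuous_on)
    show "\<tau> i j l t > 0" for i j l t using assms(1) by blast
    show "e i = 1 \<or> e i = - 1" for i by (simp add: e_def)
    show "s j \<ge> 0" for j by (rule less_imp_le[OF s_pos])
    show "\<bar>g j (\<sigma> j * x) - g j (\<sigma> j * y)\<bar> \<le> s j * \<bar>x - y\<bar>" if "e j * x \<le> b j" "e j * y \<le> b j" for j x y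
    proof -
      have "\<exists>z\<in>{\<beta> j, \<alpha> j}. \<bar>g j (\<sigma> j * x) - g j (\<sigma> j * y)\<bar> \<le> deriv (g j) (\<sigma> j * z) * \<bar>\<sigma> j * x - \<sigma> j * y\<bar>"
      proof (cases "\<Sigma> j = 1")
        case True
        then have "\<sigma> j * x \<le> \<sigma> j * \<beta> j \<and> \<sigma> j * y \<le> \<sigma> j * \<beta> j \<and> \<sigma> j * \<beta> j \<le> 0"
          using that \<beta>(1)[of j] \<sigma>[of j] by (simp add: e_def b_def mult_le_0_iff)
        then show ?thesis using class_A_lipschitz[OF f] by blast
      next
        case False
        then have "\<sigma> j * \<alpha> j \<le> \<sigma> j * x \<and> \<sigma> j * \<alpha> j \<le> \<sigma> j * y \<and> 0 \<le> \<sigma> j * \<alpha> j"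
          using that \<alpha>(1)[of j] \<sigma>[of j] by (simp add: e_def b_def)
        then show ?thesis using class_A_lipschitz[OF f] by blast
      qed
      then obtain z where z: "z \<in> {\<beta> j, \<alpha> j}"
        "\<bar>g j (\<sigma> j * x) - g j (\<sigma> j * y)\<bar> \<le> deriv (g j) (\<sigma> j * z) * \<bar>\<sigma> j * x - \<sigma> j * y\<bar>" by blast
      have "deriv (g j) (\<sigma> j * z) \<le> \<gamma> j" using z(1) by (auto simp: \<gamma>_def)
      then have "deriv (g j) (\<sigma> j * z) * \<bar>\<sigma> j * x - \<sigma> j * y\<bar> \<le> \<gamma> j * \<bar>\<sigma> j * x - \<sigma> j * y\<bar>"
        by (intro mult_right_mono) auto
      also have "\<bar>\<sigma> j * x - \<sigma> j * y\<bar> = \<sigma> j * \<bar>x - y\<bar>"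
        using \<sigma>[of j] by (simp add: abs_mult flip: right_diff_distrib)
      finally show ?thesis using z(2) unfolding s_def \<open>\<bar>\<sigma> j * x - \<sigma> j * y\<bar> = \<sigma> j * \<bar>x - y\<bar>\<close>
        by (simp add: mult_ac)
    qed
    show "e i * forcing a g \<sigma> \<tau> J u i t \<le> c i t * b i"
      if u: "\<And>j l. e j * u j (t - \<tau> i j l t) \<le> b j" for u i t
    proof -
      let ?S = "\<Sum>l\<in>UNIV. a i i l t * g i (\<sigma> i * u i (t - \<tau> i i l t))"
      have cross: "\<bar>forcing a g \<sigma> \<tau> J u i t - ?S - J i t\<bar> \<le> cross_bound a B i"
        by (rule forcing_cross_bound) (use almost_periodic_bdd[OF ap(2)] g_le in auto)
      have mono: "g i (\<sigma> i * x) \<le> g i (\<sigma> i * y)" if "x \<le> y" for x y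
        using class_A_strict_mono[OF f] that \<sigma>[of i] by (cases "x = y") (auto intro: less_imp_le)
      show ?thesis
      proof (cases "\<Sigma> i = 1")
        case True
        \<comment> \<open>Since \<open>g i\<close> is negative at
          \<open>\<sigma> i * \<beta> i\<close>, replacing the diagonal sum by its infimum
          \<open>I i\<close> raises the bound. The equation defining \<open>\<beta> i\<close> turns
          the total into \<open>C i * \<beta> i\<close>, and \<open>\<beta> i < 0\<close> lets
          \<open>c i t\<close> replace its supremum. The other case is the mirror image.\<close>
        have "?S \<le> (\<Sum>l\<in>UNIV. a i i l t * g i (\<sigma> i * \<beta> i))"
          using u[of i] True less_imp_le[OF a_pos]
          by (intro sum_mono mult_left_mono mono) (auto simp: e_def b_def)
        also have "\<dots> = (\<Sum>l\<in>UNIV. a i i l t) * g i (\<sigma> i * \<beta> i)" by (simp add: sum_distrib_right)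
        also have "\<dots> \<le> I i * g i (\<sigma> i * \<beta> i)"
          using mono[of "\<beta> i" 0] \<beta>(1)[of i] g_0[of i] by (intro mult_right_mono_neg I_le) simp
        finally have "forcing a g \<sigma> \<tau> J u i t \<le> C i * \<beta> i"
          using cross J_le[of i t] \<beta>(2)[of i] by linarith
        also have "\<dots> \<le> c i t * \<beta> i" using \<beta>(1)[of i] by (intro mult_right_mono_neg c_le) simp
        finally show ?thesis using True by (simp add: e_def b_def)
      next
        case False
        have "I i * g i (\<sigma> i * \<alpha> i) \<le> (\<Sum>l\<in>UNIV. a i i l t) * g i (\<sigma> i * \<alpha> i)"
          using mono[of 0 "\<alpha> i"] \<alpha>(1)[of i] g_0[of i] by (intro mult_right_mono I_le) simp
        also have "\<dots> = (\<Sum>l\<in>UNIV. a i i l t * g i (\<sigma> i * \<alpha> i))" by (simp add: sum_distrib_right)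
        also have "\<dots> \<le> ?S"
          using u[of i] False less_imp_le[OF a_pos]
          by (intro sum_mono mult_left_mono mono) (auto simp: e_def b_def)
        finally have "C i * \<alpha> i \<le> forcing a g \<sigma> \<tau> J u i t"
          using cross J_ge[of i t] \<alpha>(2)[of i] by linarith
        moreover have "c i t * \<alpha> i \<le> C i * \<alpha> i" using \<alpha>(1)[of i] by (intro mult_right_mono c_le) simp
        ultimately show ?thesis using False by (simp add: e_def b_def)
      qed
    qed
  qed
  have "\<phi> \<in> basin (max_delay \<kappa>) \<beta> \<alpha> \<Sigma> \<longleftrightarrow> (\<forall>i. continuous_on {- max_delay \<kappa>..0} (\<lambda>s. \<phi> s $ i)) \<and>
    (\<forall>s\<in>{- max_delay \<kappa>..0}. in_sector (\<lambda>i t. \<phi> t $ i) s)" for \<phi>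
  proof -
    have "(if \<Sigma> i = 1 then x \<le> \<beta> i else x \<ge> \<alpha> i) \<longleftrightarrow> e i * x \<le> b i" for i x
      by (simp add: e_def b_def)
    then show ?thesis unfolding basin_def basin_comp_def in_sector_def by auto
  qed
  then show "\<exists>!u. almost_periodic_vec u \<and> gnn_solution c a g \<sigma> \<tau> J u \<and>
    exp_stable_in c a g \<sigma> \<tau> \<kappa> J (basin (max_delay \<kappa>) \<beta> \<alpha> \<Sigma>) u"
    by (rule unique_exp_stable_solution[OF _ refl])
qed

end
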